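(* Let $s>0$, let $\mathcal H$ be a Hilbert space, and let $\mathcal T:L^2(\mathbb R^2)\to\mathcal H$ be nonexpansive, i.e. $\|\mathcal Tf-\mathcal Tg\|_{\mathcal H}\le\|f-g\|_{L^2}$ for all $f,g\in L^2(\mathbb R^2)$. There exists $C_s>0$ (depending only on $s$) such that $$\|\mathcal T(L_\tau f)-\mathcal Tf\|_{\mathcal H}\le C_s\,\|\tau\|_{L^\infty}^{\min\{s,1\}}\,\|f\|_{H^s}$$ whenever $f\in H^s(\mathbb R^2)$, $\tau\in C_b^1(\mathbb R^2;\mathbb R^2)$, $\|D\tau\|_{L^\infty}\le\frac12$, and $\|\tau\|_{L^\infty}\le1$. The exponent $\min\{s,1\}$ is optimal for the corresponding input-space estimate: for the constant deformation $\tau\equiv y\in\mathbb R^2$, $$\|L_y-\mathrm{Id}\|_{H^s\to L^2}\asymp_s|y|^{\min\{s,1\}}\qquad\text{as }|y|\downarrow0 .$$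
   Context: $L_\tau f(x)=f(x-\tau(x))$ and $L_yf(x)=f(x-y)$. $\widehat f(\xi)=\int_{\mathbb R^2}e^{-2\pi\mathrm i x\cdot\xi}f(x)\,dx$ and $\|f\|_{H^s}=\|(1+|\xi|^2)^{s/2}\widehat f\|_{L^2}$. $C_b^1(\mathbb R^2;\mathbb R^2)$ is the space of $C^1$ vector fields which are bounded together with their first derivatives; $\|D\tau\|_{L^\infty}$ is the supremum of the operator norm of $D\tau(x)$. $X\asymp_sY$ means two-sided bounds with positive constants depending only on $s$ (here for all sufficiently small $|y|>0$). *)

theory Defs
  imports "HOL-Analysis.Analysis"
begin

text \<open>
  Elements of \<open>L\<^sup>2(\<real>\<^sup>2)\<close> are represented by Borel representatives; no quotient is formed.  A map on
  representatives that is nonexpansive for the seminorm below identifies functions that agree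
  almost everywhere, so it is the same thing as a nonexpansive map on the quotient.
\<close>

definition L2 :: "(real^2 \<Rightarrow> complex) set" where
  "L2 = {f \<in> borel_measurable lborel. integrable lborel (\<lambda>x. (norm (f x))\<^sup>2)}"

definition L2_norm :: "(real^2 \<Rightarrow> complex) \<Rightarrow> real" where
  "L2_norm f = sqrt (LINT x|lborel. (norm (f x))\<^sup>2)"

definition nonexpansive_L2 :: "((real^2 \<Rightarrow> complex) \<Rightarrow> 'h::real_normed_vector) \<Rightarrow> bool" where
  "nonexpansive_L2 T \<longleftrightarrow>
     (\<forall>f\<in>L2. \<forall>g\<in>L2. norm (T f - T g) \<le> L2_norm (\<lambda>x. f x - g x))"

definition fourier_integral :: "(real^2 \<Rightarrow> complex) \<Rightarrow> real^2 \<Rightarrow> complex" where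
  "fourier_integral f \<xi> =
     (LINT x|lborel. exp (- (2 * complex_of_real pi * \<i> * complex_of_real (x \<bullet> \<xi>))) * f x)"

text \<open>
  The integral above converges absolutely only for integrable \<open>f\<close>.  On \<open>L\<^sup>2\<close> the transform is, as
  usual, the \<open>L\<^sup>2\<close> limit of the transforms of the truncations of \<open>f\<close> to balls; it is determined up
  to null sets.  The limit is expressed with the nonnegative integral, which is \<open>\<infinity>\<close> rather than a
  default value when a difference fails to be square integrable.
\<close>

definition fourier_L2 :: "(real^2 \<Rightarrow> complex) \<Rightarrow> real^2 \<Rightarrow> complex" where
  "fourier_L2 f = (SOME g. g \<in> L2 \<and>
     (\<lambda>n::nat. \<integral>\<^sup>+ \<xi>. ennreal ((norm (fourier_integral
         (\<lambda>x. indicator (cball 0 (real n)) x * f x) \<xi> - g \<xi>))\<^sup>2) \<partial>lborel) \<longlonglongrightarrow> 0)"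

definition sobolev_weighted :: "real \<Rightarrow> (real^2 \<Rightarrow> complex) \<Rightarrow> real^2 \<Rightarrow> complex" where
  "sobolev_weighted s f \<xi> = complex_of_real ((1 + (norm \<xi>)\<^sup>2) powr (s / 2)) * fourier_L2 f \<xi>"

definition Hs :: "real \<Rightarrow> (real^2 \<Rightarrow> complex) set" where
  "Hs s = {f \<in> L2. sobolev_weighted s f \<in> L2}"

definition Hs_norm :: "real \<Rightarrow> (real^2 \<Rightarrow> complex) \<Rightarrow> real" where
  "Hs_norm s f = L2_norm (sobolev_weighted s f)"

text \<open>
  \<open>sup_norm\<close> is only applied to bounded continuous functions, where the supremum is a genuine one
  and equals the essential supremum.
\<close>

definition sup_norm :: "(real^2 \<Rightarrow> 'b::real_normed_vector) \<Rightarrow> real" where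
  "sup_norm h = (SUP x. norm (h x))"

text \<open>The norm of a \<open>blinfun\<close> is the operator norm.\<close>

definition Deriv :: "(real^2 \<Rightarrow> real^2) \<Rightarrow> real^2 \<Rightarrow> ((real^2) \<Rightarrow>\<^sub>L (real^2))" where
  "Deriv \<tau> x = Blinfun (frechet_derivative \<tau> (at x))"

definition Cb1 :: "(real^2 \<Rightarrow> real^2) set" where
  "Cb1 = {\<tau>. (\<forall>x. \<tau> differentiable at x) \<and> continuous_on UNIV (Deriv \<tau>) \<and>
             bounded (range \<tau>) \<and> bounded (range (Deriv \<tau>))}"

definition deform :: "(real^2 \<Rightarrow> real^2) \<Rightarrow> (real^2 \<Rightarrow> complex) \<Rightarrow> real^2 \<Rightarrow> complex" where
  "deform \<tau> f x = f (x - \<tau> x)"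

definition input_stability_bound :: "real \<Rightarrow> real \<Rightarrow> bool" where
  "input_stability_bound s C \<longleftrightarrow>
     (\<forall>f\<in>Hs s. \<forall>\<tau>\<in>Cb1. sup_norm (Deriv \<tau>) \<le> 1 / 2 \<longrightarrow> sup_norm \<tau> \<le> 1 \<longrightarrow>
        L2_norm (\<lambda>x. deform \<tau> f x - f x) \<le> C * sup_norm \<tau> powr min s 1 * Hs_norm s f)"

text \<open>
  The operator norm of \<open>L\<^sub>y - Id\<close> from \<open>H\<^sup>s\<close> to \<open>L\<^sup>2\<close>, with values in \<open>[0,\<infinity>]\<close> so that no boundedness
  is presupposed.
\<close>

definition translation_opnorm :: "real \<Rightarrow> real^2 \<Rightarrow> ennreal" where
  "translation_opnorm s y =
     (SUP f\<in>{f \<in> Hs s. Hs_norm s f \<le> 1}. ennreal (L2_norm (\<lambda>x. deform (\<lambda>_. y) f x - f x)))"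

text \<open>
  Uniformity of the constant.  The constant in the main estimate may depend on \<open>s\<close> but not on the
  Hilbert space \<open>'h\<close>, and HOL cannot quantify over the type \<open>'h\<close> underneath an existential
  quantifier.  The theorem therefore first asserts that some positive \<open>C\<close> satisfies
  \<open>input_stability_bound s C\<close>, the case of the identity map on \<open>L\<^sup>2\<close>, in which \<open>'h\<close> does not occur,
  and then that every such \<open>C\<close> serves for every \<open>'h\<close> and every nonexpansive map into it.
\<close>

end

theory Submission
  imports Defs "HOL-Probability.Characteristic_Functions"
begin

text \<open>
  Write \<open>|f|\<close> for the \<open>L\<^sup>2\<close> norm, \<open>m = min s 1\<close>, and \<open>\<omega>(z) = |L\<^sub>z f - f|\<^sup>2\<close>.  A nonexpansive map cannot
  enlarge \<open>|L\<^sub>\<tau> f - f|\<close>, so only the input space matters.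

  Upper bound.  On the Fourier side \<open>L\<^sub>z - Id\<close> is multiplication by \<open>exp (-2\<pi>i z\<cdot>\<xi>) - 1\<close>, whose modulus is at
  most \<open>2\<pi>\<close> times the power \<open>m\<close> of \<open>|z| |\<xi>|\<close>.  Plancherel therefore gives
  \<open>\<omega>(z) \<le> C |z|\<close> to the power \<open>2m\<close>, times the squared \<open>H\<^sup>s\<close> norm (\<open>translation_energy_le_Hs\<close>).
  An averaging argument passes from translations to deformations.  With \<open>\<delta> = sup |\<tau>|\<close>, every \<open>z\<close> in
  the ball of radius \<open>\<delta>\<close> gives
  \<open>f(x - \<tau>(x)) - f(x) = [f(x - \<tau>(x)) - f(x - \<tau>(x) - z)] + [f(x - \<tau>(x) - z) - f(x)]\<close>.
  Square, average over \<open>z\<close>, and integrate over \<open>x\<close>.  In the first bracket the change of variables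
  \<open>x \<mapsto> x - \<tau>(x)\<close>, whose Jacobian determinant is at least \<open>1/4\<close> when \<open>|D\<tau>| \<le> 1/2\<close>, leaves an average
  of \<open>\<omega>\<close>.  In the second one the vector \<open>w = z + \<tau>(x)\<close> lies in the ball of radius \<open>2\<delta>\<close>, and replacing
  \<open>z\<close> by \<open>w\<close> again leaves an average of \<open>\<omega>\<close> (\<open>deformation_energy_le_translations\<close>).

  Lower bound.  Let \<open>f\<close> be the Gaussian \<open>exp (-\<pi>|x|\<^sup>2)\<close> modulated to the frequency \<open>\<eta>\<close>.  Its \<open>H\<^sup>s\<close> norm is
  at most a constant times the weight \<open>1 + |\<eta>|\<^sup>2\<close> to the power \<open>s/2\<close>, while \<open>|L\<^sub>y f - f|\<close> is at least
  \<open>|sin (2\<pi> y\<cdot>\<eta>)|\<close> times the norm of the Gaussian, because no real multiple of the second summand cancels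
  the imaginary part of the relative phase (\<open>translation_opnorm_ge\<close>).  A frequency of size \<open>1/(4|y|)\<close> in the direction of \<open>y\<close> gives the
  exponent \<open>s\<close>, and one of size \<open>1/4\<close> gives the exponent \<open>1\<close>.

  Plancherel (\<open>plancherel\<close>) is proved for \<open>L\<^sup>1 \<inter> L\<^sup>2\<close> by Gaussian regularisation: twice the integral of
  the squared transform against a wide Gaussian equals \<open>2|f|\<^sup>2\<close> minus a Gaussian average of \<open>\<omega>\<close> over
  small translations, and this average tends to zero because translation is continuous in \<open>L\<^sup>2\<close>.
  Completeness of \<open>L\<^sup>2\<close> (\<open>energy_complete\<close>) then yields the transform on all of \<open>L\<^sup>2\<close> as the limit over
  truncations.  Since the constants are free, the inequality
  \<open>|a + b|\<^sup>2 \<le> 2|a|\<^sup>2 + 2|b|\<^sup>2\<close> replaces Minkowski's inequality throughout.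
\<close>

section \<open>Translation invariance and the squared norm\<close>

lemma distr_lborel_diff_right: "distr lborel borel (\<lambda>x. x - z) = (lborel :: 'a::euclidean_space measure)"
proof -
  have "(\<lambda>x. x - z) = (+) (- z)" by auto
  then show ?thesis using lborel_distr_plus[of "- z"] by simp
qed

lemma nn_integral_lborel_translate:
  fixes z :: "'a::euclidean_space"
  assumes [measurable]: "h \<in> borel_measurable borel"
  shows "(\<integral>\<^sup>+x. h (x - z) \<partial>lborel) = (\<integral>\<^sup>+x. h x \<partial>lborel)"
proof -
  have "(\<integral>\<^sup>+x. h x \<partial>lborel) = (\<integral>\<^sup>+x. h x \<partial>distr lborel borel (\<lambda>x. x - z))"
    by (simp add: distr_lborel_diff_right)
  also have "\<dots> = (\<integral>\<^sup>+x. h (x - z) \<partial>lborel)"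
    by (subst nn_integral_distr) auto
  finally show ?thesis ..
qed

lemma ennreal_tendsto_zeroI:
  fixes F :: "'i \<Rightarrow> ennreal"
  assumes "\<And>e::real. 0 < e \<Longrightarrow> eventually (\<lambda>n. F n \<le> ennreal e) G"
  shows "(F \<longlongrightarrow> 0) G"
proof (rule order_tendstoI)
  fix a :: ennreal assume "0 < a"
  then obtain e where e: "0 < e" "e < a" using dense by blast
  then have "e < top" by (meson less_le_trans top_greatest)
  with e have "0 < enn2real e" "ennreal (enn2real e) = e"
    by (auto simp: enn2real_positive_iff)
  with assms[of "enn2real e"] e show "eventually (\<lambda>n. F n < a) G"
    by (auto elim!: eventually_mono)
qed auto

lemma ennreal_tendsto_zeroD:
  fixes F :: "'i \<Rightarrow> ennreal"
  assumes "(F \<longlongrightarrow> 0) G" "0 < (e::real)"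
  shows "eventually (\<lambda>n. F n \<le> ennreal e) G"
  using order_tendstoD(2)[OF assms(1), of "ennreal e"] assms(2)
  by (auto elim!: eventually_mono)

lemma ennreal_tendsto_zero_le:
  fixes F :: "'i \<Rightarrow> ennreal"
  assumes "\<And>n. F n \<le> H n" "(H \<longlongrightarrow> 0) G"
  shows "(F \<longlongrightarrow> 0) G"
  by (rule tendsto_sandwich[OF _ _ tendsto_const assms(2)]) (auto intro: always_eventually assms(1))

lemma integral_lborel_translate:
  fixes z :: "'a::euclidean_space" and h :: "'a \<Rightarrow> 'b::{banach,second_countable_topology}"
  assumes [measurable]: "h \<in> borel_measurable borel"
  shows "(LINT x|lborel. h (x - z)) = (LINT x|lborel. h x)"
proof -
  have "(LINT x|lborel. h x) = (LINT x|distr lborel borel (\<lambda>x. x - z). h x)"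
    by (simp add: distr_lborel_diff_right)
  also have "\<dots> = (LINT x|lborel. h (x - z))"
    by (subst integral_distr) auto
  finally show ?thesis ..
qed

lemma
  fixes k :: "'a::euclidean_space \<Rightarrow> 'b::{banach,second_countable_topology}"
  assumes c: "c > 0"
  shows integral_lborel_affine: "k \<in> borel_measurable borel \<Longrightarrow>
      (LINT y|lborel. k y) = c ^ DIM('a) *\<^sub>R (LINT u|lborel. k (t + c *\<^sub>R u))"
    and integrable_lborel_affine: "integrable lborel k \<Longrightarrow> integrable lborel (\<lambda>u. k (t + c *\<^sub>R u))"
proof -
  have eq: "lborel = density (distr lborel borel (\<lambda>x::'a. t + c *\<^sub>R x)) (\<lambda>_. c ^ DIM('a))"
    using lborel_affine[of c t] c by simp
  show "(LINT y|lborel. k y) = c ^ DIM('a) *\<^sub>R (LINT u|lborel. k (t + c *\<^sub>R u))"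
    if [measurable]: "k \<in> borel_measurable borel"
    using c by (subst eq, subst integral_density, auto, subst integral_distr, auto)
  show "integrable lborel (\<lambda>u. k (t + c *\<^sub>R u))" if k: "integrable lborel k"
  proof -
    have [measurable]: "k \<in> borel_measurable borel" using k by simp
    have "integrable (density (distr lborel borel (\<lambda>x::'a. t + c *\<^sub>R x)) (\<lambda>_. c ^ DIM('a))) k"
      using k eq by simp
    then have "integrable lborel (\<lambda>u. c ^ DIM('a) *\<^sub>R k (t + c *\<^sub>R u))"
      using c by (subst (asm) integrable_density, simp_all, subst (asm) integrable_distr_eq, simp_all)
    then have "integrable lborel (\<lambda>u. inverse (c ^ DIM('a)) *\<^sub>R (c ^ DIM('a) *\<^sub>R k (t + c *\<^sub>R u)))"
      by (rule integrable_scaleR_right)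
    moreover have "inverse (c ^ DIM('a)) *\<^sub>R (c ^ DIM('a) *\<^sub>R k (t + c *\<^sub>R u)) = k (t + c *\<^sub>R u)" for u
      using c by simp
    ultimately show ?thesis by (simp only:)
  qed
qed

text \<open>
  The squared \<open>L\<^sup>2\<close> norm with values in \<open>[0,\<infinity>]\<close>: limits, Tonelli and comparison arguments need no
  integrability side conditions in this form.
\<close>

definition energy :: "('a::euclidean_space \<Rightarrow> complex) \<Rightarrow> ennreal" where
  "energy f = (\<integral>\<^sup>+x. ennreal ((norm (f x))\<^sup>2) \<partial>lborel)"

lemma energy_add_le:
  assumes [measurable]: "f \<in> borel_measurable borel" "g \<in> borel_measurable borel"
  shows "energy (\<lambda>x. f x + g x) \<le> 2 * energy f + 2 * energy g"
proof -
  have "energy (\<lambda>x. f x + g x) \<le> (\<integral>\<^sup>+x. 2 * ennreal ((norm (f x))\<^sup>2) + 2 * ennreal ((norm (g x))\<^sup>2) \<partial>lborel)"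
    unfolding energy_def
  proof (intro nn_integral_mono)
    fix x
    have "(norm (f x + g x))\<^sup>2 \<le> (norm (f x) + norm (g x))\<^sup>2"
      by (intro power_mono norm_triangle_ineq) auto
    also have "\<dots> \<le> 2 * (norm (f x))\<^sup>2 + 2 * (norm (g x))\<^sup>2"
      using zero_le_power2[of "norm (f x) - norm (g x)"] unfolding power2_sum power2_diff by linarith
    finally show "ennreal ((norm (f x + g x))\<^sup>2) \<le> 2 * ennreal ((norm (f x))\<^sup>2) + 2 * ennreal ((norm (g x))\<^sup>2)"
      by (simp flip: ennreal_plus ennreal_mult' ennreal_numeral add: ennreal_leI)
  qed
  also have "\<dots> = 2 * energy f + 2 * energy g"
    unfolding energy_def by (subst nn_integral_add; simp add: nn_integral_cmult)
  finally show ?thesis .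
qed

lemma energy_uminus [simp]: "energy (\<lambda>x. - f x) = energy f"
  by (simp add: energy_def)

lemma energy_diff_le:
  assumes [measurable]: "f \<in> borel_measurable borel" "g \<in> borel_measurable borel"
  shows "energy (\<lambda>x. f x - g x) \<le> 2 * energy f + 2 * energy g"
  using energy_add_le[of f "\<lambda>x. - g x"] by simp

lemma energy_translate:
  assumes [measurable]: "f \<in> borel_measurable borel"
  shows "energy (\<lambda>x. f (x - z)) = energy f"
  unfolding energy_def by (rule nn_integral_lborel_translate) measurable

lemma energy_finite_iff:
  assumes [measurable]: "f \<in> borel_measurable borel"
  shows "energy f < \<infinity> \<longleftrightarrow> integrable lborel (\<lambda>x. (norm (f x))\<^sup>2)"
  unfolding energy_def by (simp add: integrable_iff_bounded)

lemma energy_eq_integral: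
  assumes [measurable]: "f \<in> borel_measurable borel" and "energy f < \<infinity>"
  shows "energy f = ennreal (LINT x|lborel. (norm (f x))\<^sup>2)"
  using assms unfolding energy_def
  by (intro nn_integral_eq_integral) (auto simp flip: energy_finite_iff simp: energy_def)

lemma L2_iff_energy: "f \<in> L2 \<longleftrightarrow> f \<in> borel_measurable borel \<and> energy f < \<infinity>"
  using energy_finite_iff by (auto simp: L2_def)

lemma L2_norm_power2: "f \<in> L2 \<Longrightarrow> energy f = ennreal ((L2_norm f)\<^sup>2)"
  unfolding L2_iff_energy by (simp add: energy_eq_integral L2_norm_def)

lemma L2_norm_nonneg [simp]: "L2_norm f \<ge> 0"
  by (simp add: L2_norm_def)

lemma L2_norm_le_energy:
  assumes "f \<in> borel_measurable borel" "energy f \<le> ennreal (B\<^sup>2)" "B \<ge> 0"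
  shows "f \<in> L2" "L2_norm f \<le> B"
proof -
  show f: "f \<in> L2"
    using assms by (auto simp: L2_iff_energy intro: le_less_trans)
  with assms have "(L2_norm f)\<^sup>2 \<le> B\<^sup>2" by (simp add: L2_norm_power2)
  then show "L2_norm f \<le> B" by (rule power2_le_imp_le) fact
qed

lemma L2_norm_ge_energy:
  assumes "f \<in> L2" "ennreal (B\<^sup>2) \<le> energy f"
  shows "B \<le> L2_norm f"
proof -
  have "B\<^sup>2 \<le> (L2_norm f)\<^sup>2" using assms by (simp add: L2_norm_power2)
  then show ?thesis by (rule power2_le_imp_le) simp
qed

lemma L2_diff: "f \<in> L2 \<Longrightarrow> g \<in> L2 \<Longrightarrow> (\<lambda>x. f x - g x) \<in> L2"
  using energy_diff_le[of f g]
  by (auto simp: L2_iff_energy ennreal_mult_less_top intro: le_less_trans)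

section \<open>Continuity of translation in mean square\<close>

text \<open>
  The modulus of continuity of translation in \<open>L\<^sup>1\<close>.
\<close>

definition translation_gap :: "('a::euclidean_space \<Rightarrow> 'b::{banach,second_countable_topology}) \<Rightarrow> 'a \<Rightarrow> ennreal"
  where "translation_gap f z = (\<integral>\<^sup>+x. ennreal (norm (f (x - z) - f x)) \<partial>lborel)"

lemma translation_gap_approx:
  assumes f [measurable]: "f \<in> borel_measurable borel" and g [measurable]: "g \<in> borel_measurable borel"
  shows "translation_gap f z \<le> 2 * (\<integral>\<^sup>+x. ennreal (norm (f x - g x)) \<partial>lborel) + translation_gap g z"
proof -
  have "translation_gap f z \<le> (\<integral>\<^sup>+x. ennreal (norm (f (x - z) - g (x - z))) + ennreal (norm (f x - g x))
       + ennreal (norm (g (x - z) - g x)) \<partial>lborel)"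
    unfolding translation_gap_def
  proof (intro nn_integral_mono)
    fix x
    have "norm (f (x - z) - f x) \<le> norm (f (x - z) - g (x - z)) + norm (f x - g x) + norm (g (x - z) - g x)"
      by norm
    then show "ennreal (norm (f (x - z) - f x)) \<le> ennreal (norm (f (x - z) - g (x - z))) + ennreal (norm (f x - g x))
       + ennreal (norm (g (x - z) - g x))"
      by (simp flip: ennreal_plus)
  qed
  also have "\<dots> = (\<integral>\<^sup>+x. ennreal (norm (f (x - z) - g (x - z))) \<partial>lborel) + (\<integral>\<^sup>+x. ennreal (norm (f x - g x)) \<partial>lborel)
      + translation_gap g z"
    unfolding translation_gap_def by (subst nn_integral_add; simp)+
  also have "(\<integral>\<^sup>+x. ennreal (norm (f (x - z) - g (x - z))) \<partial>lborel) = (\<integral>\<^sup>+x. ennreal (norm (f x - g x)) \<partial>lborel)"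
    by (rule nn_integral_lborel_translate) measurable
  finally show ?thesis by (simp add: mult_2)
qed

lemma translation_gap_tendsto_closed:
  fixes z :: "nat \<Rightarrow> 'a::euclidean_space"
  assumes f [measurable]: "f \<in> borel_measurable borel"
    and approx: "\<And>e::real. 0 < e \<Longrightarrow> \<exists>g\<in>borel_measurable borel.
      (\<integral>\<^sup>+x. ennreal (norm (f x - g x)) \<partial>lborel) \<le> ennreal e \<and> (\<lambda>n. translation_gap g (z n)) \<longlonglongrightarrow> 0"
  shows "(\<lambda>n. translation_gap f (z n)) \<longlonglongrightarrow> 0"
proof (rule ennreal_tendsto_zeroI)
  fix e :: real assume e: "0 < e"
  with approx[of "e/4"] obtain g where g: "g \<in> borel_measurable borel"
    "(\<integral>\<^sup>+x. ennreal (norm (f x - g x)) \<partial>lborel) \<le> ennreal (e/4)" "(\<lambda>n. translation_gap g (z n)) \<longlonglongrightarrow> 0"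
    by auto
  have "eventually (\<lambda>n. translation_gap g (z n) \<le> ennreal (e/2)) sequentially"
    using ennreal_tendsto_zeroD[OF g(3)] e by simp
  then show "eventually (\<lambda>n. translation_gap f (z n) \<le> ennreal e) sequentially"
  proof eventually_elim
    case (elim n)
    have "translation_gap f (z n) \<le> 2 * ennreal (e/4) + ennreal (e/2)"
      by (rule order_trans[OF translation_gap_approx[OF f g(1)]]) (intro add_mono mult_left_mono g elim; simp)
    also have "\<dots> = ennreal e"
      using e by (simp flip: ennreal_plus ennreal_mult' ennreal_numeral)
    finally show ?case .
  qed
qed

text \<open>
  For an open set \<open>U\<close> the part \<open>U - (U + z)\<close> of the symmetric difference shrinks by dominated
  convergence, since each point of \<open>U\<close> stays in \<open>U\<close> under small displacements.  The other part
  \<open>(U + z) - U\<close>, for which pointwise convergence may fail on the boundary, has the same measure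
  because \<open>U\<close> and \<open>U + z\<close> do.
\<close>

lemma translation_gap_open_tendsto:
  fixes z :: "nat \<Rightarrow> 'a::euclidean_space" and c :: "'b::{banach,second_countable_topology}"
  assumes U: "open U" "emeasure lborel U < \<infinity>" and z: "z \<longlonglongrightarrow> 0"
  shows "(\<lambda>n. translation_gap (\<lambda>x. indicator U x *\<^sub>R c) (z n)) \<longlonglongrightarrow> 0"
proof -
  have [measurable]: "U \<in> sets borel" using U by simp
  let ?D = "\<lambda>n x. (indicator U x * (1 - indicator U (x - z n))) :: ennreal"
  let ?D' = "\<lambda>n x. (indicator U (x - z n) * (1 - indicator U x)) :: ennreal"
  have D0: "(\<lambda>n. \<integral>\<^sup>+x. ?D n x \<partial>lborel) \<longlonglongrightarrow> (\<integral>\<^sup>+x. 0 \<partial>(lborel :: 'a measure))"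
  proof (rule nn_integral_dominated_convergence[where w="indicator U"])
    show "AE x in lborel. (\<lambda>n. ?D n x) \<longlonglongrightarrow> 0"
    proof (rule AE_I2)
      fix x
      show "(\<lambda>n. ?D n x) \<longlonglongrightarrow> 0"
      proof (cases "x \<in> U")
        case True
        have "(\<lambda>n. x - z n) \<longlonglongrightarrow> x - 0" by (intro tendsto_intros z)
        then have "eventually (\<lambda>n. x - z n \<in> U) sequentially"
          using U True by (auto intro: topological_tendstoD)
        then have "eventually (\<lambda>n. ?D n x = 0) sequentially"
          by eventually_elim simp
        then show ?thesis by (rule tendsto_eventually)
      qed simp
    qed
    show "(\<integral>\<^sup>+x. indicator U x \<partial>lborel) < \<infinity>" using U by simp
  qed (auto split: split_indicator)
  have eq: "(\<integral>\<^sup>+x. ?D' n x \<partial>lborel) = (\<integral>\<^sup>+x. ?D n x \<partial>lborel)" for n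
  proof -
    let ?I = "\<integral>\<^sup>+x. indicator U x * indicator U (x - z n) \<partial>(lborel :: 'a measure)"
    have 1: "(\<integral>\<^sup>+x. ?D n x \<partial>lborel) + ?I = (\<integral>\<^sup>+x. indicator U x \<partial>lborel)"
      by (subst nn_integral_add[symmetric], measurable, intro nn_integral_cong) (auto split: split_indicator)
    have 2: "(\<integral>\<^sup>+x. ?D' n x \<partial>lborel) + ?I = (\<integral>\<^sup>+x. indicator U (x - z n) \<partial>lborel)"
      by (subst nn_integral_add[symmetric], measurable, intro nn_integral_cong) (auto split: split_indicator)
    have 3: "(\<integral>\<^sup>+x. indicator U (x - z n) \<partial>lborel) = (\<integral>\<^sup>+x. indicator U x \<partial>(lborel :: 'a measure))"
      by (rule nn_integral_lborel_translate) measurable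
    have "?I \<le> (\<integral>\<^sup>+x. indicator U x \<partial>lborel)"
      by (intro nn_integral_mono) (auto split: split_indicator)
    then have "?I \<noteq> \<infinity>" using U by (auto simp: top_unique)
    moreover have "?I + (\<integral>\<^sup>+x. ?D' n x \<partial>lborel) = ?I + (\<integral>\<^sup>+x. ?D n x \<partial>lborel)"
      using 1 2 3 by (simp only: add.commute)
    ultimately show ?thesis unfolding ennreal_add_left_cancel by simp
  qed
  have "translation_gap (\<lambda>x. indicator U x *\<^sub>R c) (z n) = ennreal (norm c) * (2 * (\<integral>\<^sup>+x. ?D n x \<partial>lborel))" for n
  proof -
    have "translation_gap (\<lambda>x. indicator U x *\<^sub>R c) (z n) = (\<integral>\<^sup>+x. ennreal (norm c) * (?D n x + ?D' n x) \<partial>lborel)"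
      unfolding translation_gap_def by (intro nn_integral_cong) (auto split: split_indicator)
    also have "\<dots> = ennreal (norm c) * ((\<integral>\<^sup>+x. ?D n x \<partial>lborel) + (\<integral>\<^sup>+x. ?D' n x \<partial>lborel))"
      by (subst nn_integral_cmult, measurable, subst nn_integral_add) auto
    finally show ?thesis unfolding eq mult_2 .
  qed
  moreover have "(\<lambda>n. ennreal (norm c) * (2 * (\<integral>\<^sup>+x. ?D n x \<partial>lborel))) \<longlonglongrightarrow> ennreal (norm c) * (2 * 0)"
    using D0 by (intro ennreal_tendsto_cmult) (auto intro: ennreal_tendsto_cmult)
  ultimately show ?thesis by simp
qed

text \<open>
  Functions with this property are closed under sums and under \<open>L\<^sup>1\<close> limits, and indicators of
  measurable sets are \<open>L\<^sup>1\<close> limits of indicators of open sets by outer regularity.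
\<close>

proposition translation_gap_tendsto:
  fixes z :: "nat \<Rightarrow> 'a::euclidean_space" and f :: "'a \<Rightarrow> 'b::{banach,second_countable_topology}"
  assumes "integrable lborel f" and z: "z \<longlonglongrightarrow> 0"
  shows "(\<lambda>n. translation_gap f (z n)) \<longlonglongrightarrow> 0"
  using assms(1)
proof (induction rule: integrable_induct)
  case (base A c)
  then have A [measurable]: "A \<in> sets borel" by simp
  show ?case
  proof (rule translation_gap_tendsto_closed)
    fix e :: real assume e: "0 < e"
    \<comment> \<open>The summand \<open>1\<close> covers \<open>c = 0\<close>.\<close>
    define d where "d = e / (norm c + 1)"
    have "0 < norm c + 1" using norm_ge_zero[of c] by linarith
    with e have d: "d > 0" by (simp add: d_def)
    obtain U where U: "open U" "A \<subseteq> U" "emeasure lborel (U - A) < ennreal d"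
      using outer_regular_lborel[OF A d] .
    then have [measurable]: "U \<in> sets borel" by simp
    have "emeasure lborel U \<le> emeasure lborel A + emeasure lborel (U - A)"
      using U by (intro order_trans[OF _ emeasure_subadditive] emeasure_mono) auto
    also have "\<dots> < \<infinity>" using base(2) U(3) by (auto simp: less_top[symmetric] top_unique)
    finally have fin: "emeasure lborel U < \<infinity>" .
    have "(\<integral>\<^sup>+x. ennreal (norm (indicator A x *\<^sub>R c - indicator U x *\<^sub>R c)) \<partial>lborel)
        = (\<integral>\<^sup>+x. ennreal (norm c) * indicator (U - A) x \<partial>lborel)"
      using U(2) by (intro nn_integral_cong) (auto split: split_indicator)
    also have "\<dots> = ennreal (norm c) * emeasure lborel (U - A)"
      by (subst nn_integral_cmult) auto
    also have "\<dots> \<le> ennreal (norm c) * ennreal d" using U(3) by (intro mult_left_mono) auto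
    also have "\<dots> \<le> ennreal e"
      using e \<open>0 < norm c + 1\<close> unfolding ennreal_mult'[OF norm_ge_zero, symmetric] d_def
      by (intro ennreal_leI) (simp add: field_simps)
    finally show "\<exists>g\<in>borel_measurable borel. (\<integral>\<^sup>+x. ennreal (norm (indicator A x *\<^sub>R c - g x)) \<partial>lborel) \<le> ennreal e
        \<and> (\<lambda>n. translation_gap g (z n)) \<longlonglongrightarrow> 0"
      using translation_gap_open_tendsto[OF U(1) fin z, of c]
      by (intro bexI[of _ "\<lambda>x. indicator U x *\<^sub>R c"]) auto
  qed measurable
next
  case (add f g)
  have [measurable]: "f \<in> borel_measurable borel" "g \<in> borel_measurable borel"
    using add borel_measurable_integrable by auto
  have le: "translation_gap (\<lambda>x. f x + g x) (z n) \<le> translation_gap f (z n) + translation_gap g (z n)" for n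
  proof -
    have "translation_gap (\<lambda>x. f x + g x) (z n) \<le>
      (\<integral>\<^sup>+x. ennreal (norm (f (x - z n) - f x)) + ennreal (norm (g (x - z n) - g x)) \<partial>lborel)"
      unfolding translation_gap_def
      by (intro nn_integral_mono) (simp flip: ennreal_plus add: norm_diff_triangle_ineq)
    also have "\<dots> = translation_gap f (z n) + translation_gap g (z n)"
      unfolding translation_gap_def by (rule nn_integral_add) auto
    finally show ?thesis .
  qed
  have "(\<lambda>n. translation_gap f (z n) + translation_gap g (z n)) \<longlonglongrightarrow> 0 + 0"
    by (intro tendsto_add add)
  then show ?case
    using ennreal_tendsto_zero_le[OF le] by simp
next
  case (lim f s)
  have [measurable]: "f \<in> borel_measurable borel" "\<And>i. s i \<in> borel_measurable borel"
    using lim borel_measurable_integrable by auto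
  show ?case
  proof (rule translation_gap_tendsto_closed)
    fix e :: real assume e: "0 < e"
    have "(\<lambda>i. \<integral>\<^sup>+x. ennreal (norm (f x - s i x)) \<partial>lborel) \<longlonglongrightarrow> 0"
    proof (rule nn_integral_dominated_convergence_norm[where w="\<lambda>x. 2 * norm (f x)"])
      have "integrable lborel (\<lambda>x. 2 * norm (f x))" using lim by simp
      then show "(\<integral>\<^sup>+x. ennreal (2 * norm (f x)) \<partial>lborel) < \<infinity>"
        by (subst nn_integral_eq_integral) auto
    qed (use lim in auto)
    from ennreal_tendsto_zeroD[OF this e] obtain i where "(\<integral>\<^sup>+x. ennreal (norm (f x - s i x)) \<partial>lborel) \<le> ennreal e"
      by (auto simp: eventually_sequentially)
    with lim.IH[of i] show "\<exists>g\<in>borel_measurable borel. (\<integral>\<^sup>+x. ennreal (norm (f x - g x)) \<partial>lborel) \<le> ennreal e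
        \<and> (\<lambda>n. translation_gap g (z n)) \<longlonglongrightarrow> 0"
      by (intro bexI[of _ "s i"]) auto
  qed measurable
qed

text \<open>
  The map \<open>a \<mapsto> |a| a\<close> turns square integrable functions into integrable ones.  This Hoelder type
  estimate for its inverse carries continuity of translation from \<open>L\<^sup>1\<close> over to \<open>L\<^sup>2\<close>.  It comes from
  pairing \<open>|a| a - |b| b\<close> with \<open>a - b\<close>.
\<close>

lemma norm_diff_squared_le_signed_squares:
  fixes a b :: complex
  shows "(norm (a - b))\<^sup>2 \<le> 2 * norm (norm a *\<^sub>R a - norm b *\<^sub>R b)"
proof -
  define r t h where "r = norm a" and "t = norm b" and "h = norm a *\<^sub>R a - norm b *\<^sub>R b"
  have rt: "0 \<le> r" "0 \<le> t" by (auto simp: r_def t_def)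
  have ab: "(norm (a - b))\<^sup>2 = r\<^sup>2 + t\<^sup>2 - 2 * (a \<bullet> b)"
    by (simp add: r_def t_def power2_norm_eq_inner inner_diff_left inner_diff_right inner_commute)
  have aa: "a \<bullet> a = r\<^sup>2" "b \<bullet> b = t\<^sup>2" by (auto simp: r_def t_def power2_norm_eq_inner)
  have "h \<bullet> (a - b) = r * r\<^sup>2 + t * t\<^sup>2 - (r + t) * (a \<bullet> b)"
    unfolding h_def r_def[symmetric] t_def[symmetric]
    by (simp add: inner_diff_left inner_diff_right aa inner_commute[of b a] algebra_simps)
  also have "\<dots> = (r + t) * ((norm (a - b))\<^sup>2 / 2 + (r - t)\<^sup>2 / 2)"
    unfolding ab by (simp add: field_simps power2_eq_square)
  finally have 1: "h \<bullet> (a - b) = (r + t) * ((norm (a - b))\<^sup>2 / 2 + (r - t)\<^sup>2 / 2)" .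
  have "norm (a - b) * ((norm (a - b))\<^sup>2 / 2) \<le> (r + t) * ((norm (a - b))\<^sup>2 / 2)"
    using norm_triangle_ineq4[of a b] by (intro mult_right_mono) (auto simp: r_def t_def)
  also have "\<dots> \<le> h \<bullet> (a - b)" unfolding 1 using rt by (intro mult_left_mono) auto
  also have "\<dots> \<le> norm h * norm (a - b)" by (rule norm_cauchy_schwarz)
  finally have "norm (a - b) * (norm (a - b))\<^sup>2 \<le> norm (a - b) * (2 * norm h)" by (simp add: ac_simps)
  then show ?thesis
    unfolding h_def[symmetric] by (cases "a = b") auto
qed

lemma energy_translation_tendsto:
  fixes z :: "nat \<Rightarrow> 'a::euclidean_space"
  assumes [measurable]: "f \<in> borel_measurable borel" and fin: "energy f < \<infinity>" and z: "z \<longlonglongrightarrow> 0"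
  shows "(\<lambda>n. energy (\<lambda>x. f (x - z n) - f x)) \<longlonglongrightarrow> 0"
proof -
  \<comment> \<open>An integrable function from which \<open>f\<close> is recovered continuously.\<close>
  let ?h = "\<lambda>x. norm (f x) *\<^sub>R f x"
  have "integrable lborel ?h"
    using fin by (auto simp: integrable_iff_bounded energy_def power2_eq_square)
  from translation_gap_tendsto[OF this z] have "(\<lambda>n. translation_gap ?h (z n)) \<longlonglongrightarrow> 0" .
  then have "(\<lambda>n. 2 * translation_gap ?h (z n)) \<longlonglongrightarrow> 2 * 0"
    by (intro ennreal_tendsto_cmult) auto
  moreover have "energy (\<lambda>x. f (x - z n) - f x) \<le> 2 * translation_gap ?h (z n)" for n
  proof -
    have "energy (\<lambda>x. f (x - z n) - f x) \<le> (\<integral>\<^sup>+x. 2 * ennreal (norm (?h (x - z n) - ?h x)) \<partial>lborel)"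
      unfolding energy_def
      using norm_diff_squared_le_signed_squares
      by (intro nn_integral_mono) (auto simp flip: ennreal_mult' ennreal_numeral intro!: ennreal_leI)
    also have "\<dots> = 2 * translation_gap ?h (z n)"
      unfolding translation_gap_def by (rule nn_integral_cmult) measurable
    finally show ?thesis .
  qed
  ultimately show ?thesis
    by (intro ennreal_tendsto_zero_le[where H="\<lambda>n. 2 * translation_gap ?h (z n)" and F="\<lambda>n. energy (\<lambda>x. f (x - z n) - f x)"]) simp_all
qed

section \<open>Completeness of the space of square integrable functions\<close>

text \<open>
  A subsequence with \<open>|d\<^sub>k|\<^sup>2\<close> of integral at most \<open>4\<^sup>-\<^sup>k\<close> for its increments \<open>d\<^sub>k\<close> converges almost
  everywhere: the sum of \<open>2\<^sup>k |d\<^sub>k(x)|\<^sup>2\<close> has finite integral, so almost every \<open>|d\<^sub>k(x)|\<close> decays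
  geometrically.  Fatou's lemma turns the pointwise limit into a limit in mean square.
\<close>

theorem energy_complete:
  fixes h :: "nat \<Rightarrow> 'a::euclidean_space \<Rightarrow> complex"
  assumes meas [measurable]: "\<And>n. h n \<in> borel_measurable borel"
    and cauchy: "\<And>e::real. 0 < e \<Longrightarrow> \<exists>N. \<forall>m\<ge>N. \<forall>n\<ge>N. energy (\<lambda>x. h m x - h n x) \<le> ennreal e"
  obtains g where "g \<in> borel_measurable borel" "(\<lambda>n. energy (\<lambda>x. h n x - g x)) \<longlonglongrightarrow> 0"
proof -
  have "\<exists>N. \<forall>m\<ge>N. \<forall>n\<ge>N. energy (\<lambda>x. h m x - h n x) \<le> ennreal ((1/4)^k)" for k
    by (rule cauchy) simp
  then obtain N where N: "\<And>k m n. m \<ge> N k \<Longrightarrow> n \<ge> N k \<Longrightarrow> energy (\<lambda>x. h m x - h n x) \<le> ennreal ((1/4)^k)"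
    by metis
  \<comment> \<open>The summand \<open>k\<close> makes the indices unbounded; the sum makes them nondecreasing and at least \<open>N k\<close>.\<close>
  define J where "J k = k + (\<Sum>i\<le>k. N i)" for k
  have JN: "J k \<ge> N k" for k unfolding J_def by (intro trans_le_add2 member_le_sum) auto
  have JS: "J (Suc k) \<ge> J k" for k unfolding J_def by simp
  define d where "d k x = h (J (Suc k)) x - h (J k) x" for k x
  have [measurable]: "d k \<in> borel_measurable borel" for k unfolding d_def[abs_def] by measurable
  have dk: "energy (d k) \<le> ennreal ((1/4)^k)" for k
    unfolding d_def[abs_def] using JN[of k] JS[of k] by (intro N) auto
  have "(\<integral>\<^sup>+x. (\<Sum>k. ennreal (2^k * (norm (d k x))\<^sup>2)) \<partial>lborel) = (\<Sum>k. \<integral>\<^sup>+x. ennreal (2^k * (norm (d k x))\<^sup>2) \<partial>lborel)"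
    by (rule nn_integral_suminf) measurable
  also have "\<dots> \<le> (\<Sum>k. ennreal ((1/2)^k))"
  proof (intro suminf_le summableI)
    fix k
    have "(\<integral>\<^sup>+x. ennreal (2^k * (norm (d k x))\<^sup>2) \<partial>lborel) = ennreal (2^k) * energy (d k)"
      unfolding energy_def by (subst nn_integral_cmult[symmetric]) (auto simp: ennreal_mult')
    also have "\<dots> \<le> ennreal (2^k) * ennreal ((1/4)^k)" by (intro mult_left_mono dk) simp
    also have "\<dots> = ennreal ((1/2)^k)"
      by (subst ennreal_mult'[symmetric]) (auto simp flip: power_mult_distrib)
    finally show "(\<integral>\<^sup>+x. ennreal (2^k * (norm (d k x))\<^sup>2) \<partial>lborel) \<le> ennreal ((1/2)^k)" .
  qed
  also have "\<dots> = ennreal (\<Sum>k. (1/2)^k)" by (intro suminf_ennreal2) (auto simp: summable_geometric)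
  also have "\<dots> < \<infinity>" by simp
  finally have "AE x in lborel. (\<Sum>k. ennreal (2^k * (norm (d k x))\<^sup>2)) \<noteq> \<infinity>"
    by (intro nn_integral_PInf_AE) auto
  then have conv: "AE x in lborel. convergent (\<lambda>k. h (J k) x)"
  proof eventually_elim
    case (elim x)
    then have "summable (\<lambda>k. 2^k * (norm (d k x))\<^sup>2)"
      by (intro summable_suminf_not_top) (auto simp: top_ennreal_def[symmetric])
    then have "Bseq (\<lambda>k. 2^k * (norm (d k x))\<^sup>2)"
      by (intro convergent_imp_Bseq) (auto dest: summable_LIMSEQ_zero simp: convergent_def)
    then obtain B where B: "B > 0" "\<And>k. 2^k * (norm (d k x))\<^sup>2 \<le> B"
      unfolding Bseq_def by auto
    have "norm (d k x) \<le> sqrt B * (1 / sqrt 2)^k" for k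
    proof (rule power2_le_imp_le)
      have "(norm (d k x))\<^sup>2 \<le> B / 2^k" using B(2)[of k] by (simp add: field_simps)
      also have "\<dots> = (sqrt B * (1 / sqrt 2)^k)\<^sup>2"
        using B(1) by (simp add: power_mult_distrib power_divide flip: power_mult)
          (simp add: power_mult mult.commute[of k 2])
      finally show "(norm (d k x))\<^sup>2 \<le> (sqrt B * (1 / sqrt 2)^k)\<^sup>2" .
    qed (use B(1) in auto)
    then have "summable (\<lambda>k. d k x)"
      by (rule summable_comparison_test'[where N=0 and g="\<lambda>k. sqrt B * (1 / sqrt 2)^k", rotated])
         (auto intro!: summable_mult summable_geometric)
    then have "convergent (\<lambda>n. h (J 0) x + (\<Sum>k<n. d k x))"
      by (intro convergent_add convergent_const) (simp add: summable_iff_convergent)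
    moreover have "h (J 0) x + (\<Sum>k<n. d k x) = h (J n) x" for n
      unfolding d_def by (subst sum_lessThan_telescope) simp
    ultimately show ?case by simp
  qed
  define g where "g x = lim (\<lambda>k. h (J k) x)" for x
  have g [measurable]: "g \<in> borel_measurable borel"
    unfolding g_def[abs_def] by (rule borel_measurable_lim_metric) measurable
  have "(\<lambda>n. energy (\<lambda>x. h n x - g x)) \<longlonglongrightarrow> 0"
  proof (rule ennreal_tendsto_zeroI)
    fix e :: real assume "0 < e"
    from cauchy[OF this] obtain M where M: "\<And>m n. m \<ge> M \<Longrightarrow> n \<ge> M \<Longrightarrow> energy (\<lambda>x. h m x - h n x) \<le> ennreal e"
      by blast
    have "energy (\<lambda>x. h n x - g x) \<le> ennreal e" if n: "n \<ge> M" for n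
    proof -
      have "energy (\<lambda>x. h n x - g x) = (\<integral>\<^sup>+x. liminf (\<lambda>k. ennreal ((norm (h n x - h (J k) x))\<^sup>2)) \<partial>lborel)"
        unfolding energy_def
      proof (rule nn_integral_cong_AE)
        show "AE x in lborel. ennreal ((norm (h n x - g x))\<^sup>2) = liminf (\<lambda>k. ennreal ((norm (h n x - h (J k) x))\<^sup>2))"
          using conv
        proof eventually_elim
          case (elim x)
          then have "(\<lambda>k. h (J k) x) \<longlonglongrightarrow> g x" unfolding g_def by (simp add: convergent_LIMSEQ_iff)
          then have "(\<lambda>k. ennreal ((norm (h n x - h (J k) x))\<^sup>2)) \<longlonglongrightarrow> ennreal ((norm (h n x - g x))\<^sup>2)"
            by (intro tendsto_intros)
          then show ?case by (intro lim_imp_Liminf[symmetric]) auto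
        qed
      qed
      also have "\<dots> \<le> liminf (\<lambda>k. energy (\<lambda>x. h n x - h (J k) x))"
        unfolding energy_def by (rule nn_integral_liminf) measurable
      also have "\<dots> \<le> ennreal e"
      proof (rule Liminf_le)
        show "eventually (\<lambda>k. energy (\<lambda>x. h n x - h (J k) x) \<le> ennreal e) sequentially"
          using eventually_ge_at_top[of M] by eventually_elim (auto intro!: M n simp: J_def)
      qed simp
      finally show ?thesis .
    qed
    then show "eventually (\<lambda>n. energy (\<lambda>x. h n x - g x) \<le> ennreal e) sequentially"
      by (auto simp: eventually_sequentially)
  qed
  with g that show thesis by blast
qed

section \<open>The Fourier transform of a Gaussian\<close>

lemma
  fixes F :: "'a::euclidean_space \<Rightarrow> real \<Rightarrow> complex"
  assumes F: "\<And>b. b \<in> Basis \<Longrightarrow> integrable lborel (F b)"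
  shows integrable_lborel_prod_Basis: "integrable lborel (\<lambda>x. \<Prod>b\<in>Basis. F b (x \<bullet> b))"
    and integral_lborel_prod_Basis: "(LINT x|lborel. (\<Prod>b\<in>Basis. F b (x \<bullet> b))) = (\<Prod>b\<in>Basis. (LINT t|lborel. F b t))"
proof -
  interpret product_sigma_finite "\<lambda>_::'a. lborel :: real measure" by standard
  have [measurable]: "F b \<in> borel_measurable borel" if "b \<in> Basis" for b
    using borel_measurable_integrable[OF F[OF that]] by simp
  have m: "(\<lambda>x. \<Prod>b\<in>Basis. F b (x \<bullet> b)) \<in> borel_measurable borel"
    by measurable
  show "integrable lborel (\<lambda>x. \<Prod>b\<in>Basis. F b (x \<bullet> b))"
    by (subst lborel_eq, subst integrable_distr_eq)
       (auto simp: m intro!: product_integrable_prod F cong: prod.cong)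
  show "(LINT x|lborel. (\<Prod>b\<in>Basis. F b (x \<bullet> b))) = (\<Prod>b\<in>Basis. (LINT t|lborel. F b t))"
    by (subst lborel_eq, subst integral_distr)
       (auto simp: m intro!: product_integral_prod F cong: prod.cong)
qed

lemma
  fixes a t :: real assumes a: "a > 0"
  shows integrable_gauss_real: "integrable lborel (\<lambda>u::real. exp (- (2 * complex_of_real pi * \<i> * (u * t))) * exp (- pi * a * u\<^sup>2))"
    and integral_gauss_real: "(LINT u|lborel. exp (- (2 * complex_of_real pi * \<i> * (u * t))) * exp (- pi * a * u\<^sup>2))
       = complex_of_real (exp (- pi * t\<^sup>2 / a) / sqrt a)"
proof -
  \<comment> \<open>The scaling \<open>x = c u\<close> turns \<open>x\<^sup>2/2\<close> into \<open>\<pi> a u\<^sup>2\<close>.\<close>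
  define c where "c = sqrt (2 * pi * a)"
  define T where "T = - 2 * pi * t / c"
  have c: "c > 0" "c\<^sup>2 = 2 * pi * a" using a by (auto simp: c_def)
  have Tc: "T * c = - 2 * pi * t" using c by (simp add: T_def)
  have T2: "T\<^sup>2 / 2 = pi * t\<^sup>2 / a"
    using a c by (simp add: T_def power_divide power_mult_distrib) (simp add: power2_eq_square field_simps)
  let ?h = "\<lambda>x. std_normal_density x *\<^sub>R iexp (T * x)"
  have int_h: "integrable lborel ?h"
    by (rule_tac Bochner_Integration.integrable_bound[OF integrable_normal_density[of 1 0]]) auto
  have val: "integral\<^sup>L lborel ?h = exp (- (T\<^sup>2) / 2)"
    using char_std_normal_distribution unfolding char_def fun_eq_iff
    by (subst (asm) integral_density) auto
  have eq: "?h (0 + c * u) = (exp (- (2 * complex_of_real pi * \<i> * (u * t))) * exp (- pi * a * u\<^sup>2)) * complex_of_real (1 / sqrt (2 * pi))" for u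
  proof -
    have "(T * (c * u)) = - (2 * pi * (u * t))" using Tc by (simp flip: mult.assoc)
    then have e: "iexp (T * (c * u)) = exp (- (2 * complex_of_real pi * \<i> * (u * t)))"
      by (simp add: ac_simps)
    have "(c * u)\<^sup>2 / 2 = pi * a * u\<^sup>2" by (simp add: power_mult_distrib c)
    then have "std_normal_density (c * u) = exp (- pi * a * u\<^sup>2) * (1 / sqrt (2 * pi))"
      by (simp add: std_normal_density_def)
    then show ?thesis by (simp add: e scaleR_conv_of_real del: of_real_mult)
  qed
  have "integrable lborel (\<lambda>u. ?h (0 + c * u) * complex_of_real (sqrt (2 * pi)))"
    using lborel_integrable_real_affine[OF int_h, of c 0] c by (intro integrable_mult_left) simp
  then show "integrable lborel (\<lambda>u::real. exp (- (2 * complex_of_real pi * \<i> * (u * t))) * exp (- pi * a * u\<^sup>2))"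
    unfolding eq by simp
  have "exp (- (T\<^sup>2) / 2) = \<bar>c\<bar> *\<^sub>R (LINT u|lborel. ?h (0 + c * u))"
    unfolding val[symmetric] using c by (intro lborel_integral_real_affine) auto
  also have "\<dots> = complex_of_real (c / sqrt (2 * pi)) * (LINT u|lborel. exp (- (2 * complex_of_real pi * \<i> * (u * t))) * exp (- pi * a * u\<^sup>2))"
    unfolding eq using c by (simp add: scaleR_conv_of_real)
  also have "c / sqrt (2 * pi) = sqrt a" using a by (simp add: c_def real_sqrt_mult)
  finally show "(LINT u|lborel. exp (- (2 * complex_of_real pi * \<i> * (u * t))) * exp (- pi * a * u\<^sup>2))
       = complex_of_real (exp (- pi * t\<^sup>2 / a) / sqrt a)"
    using a T2 by (simp add: field_simps flip: of_real_mult exp_of_real)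
qed

definition gauss :: "real \<Rightarrow> real^2 \<Rightarrow> real" where
  "gauss a x = exp (- pi * a * (norm x)\<^sup>2)"

lemma gauss_pos [simp]: "0 < gauss a x" "0 \<le> gauss a x"
  by (auto simp: gauss_def)

lemma gauss_measurable [measurable]: "gauss a \<in> borel_measurable borel"
  unfolding gauss_def by measurable

text \<open>
  The integrand splits into one factor for each coordinate, which reduces the planar transform to
  the characteristic function of the normal distribution.
\<close>

lemma fourier_gauss_integrand:
  "exp (- (2 * complex_of_real pi * \<i> * complex_of_real (x \<bullet> \<xi>))) * complex_of_real (gauss a x) =
   (\<Prod>b\<in>Basis. exp (- (2 * complex_of_real pi * \<i> * ((x \<bullet> b) * (\<xi> \<bullet> b)))) * exp (- pi * a * (x \<bullet> b)\<^sup>2))"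
proof -
  have 1: "complex_of_real (x \<bullet> \<xi>) = (\<Sum>b\<in>Basis. (x \<bullet> b) * (\<xi> \<bullet> b))"
    by (simp add: euclidean_inner[of x \<xi>])
  have "(norm x)\<^sup>2 = (\<Sum>b\<in>Basis. (x \<bullet> b)\<^sup>2)"
    unfolding power2_norm_eq_inner by (subst euclidean_inner) (simp add: power2_eq_square)
  then have 2: "gauss a x = (\<Prod>b\<in>Basis. exp (- pi * a * (x \<bullet> b)\<^sup>2))"
    unfolding gauss_def by (simp add: sum_distrib_left flip: exp_sum sum_negf)
  have 3: "exp (- (2 * complex_of_real pi * \<i> * complex_of_real (x \<bullet> \<xi>))) =
      (\<Prod>b\<in>Basis. exp (- (2 * complex_of_real pi * \<i> * ((x \<bullet> b) * (\<xi> \<bullet> b)))))"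
    unfolding 1 by (simp add: sum_distrib_left flip: exp_sum sum_negf)
  show ?thesis unfolding 2 3 by (simp add: prod.distrib)
qed

lemma gauss_integrable [simp]: "a > 0 \<Longrightarrow> integrable lborel (gauss a)"
proof -
  assume a: "a > 0"
  have "integrable lborel (\<lambda>x. complex_of_real (gauss a x))"
    using fourier_gauss_integrand[of _ 0 a] integrable_gauss_real[OF a, of 0]
      integrable_lborel_prod_Basis[of "\<lambda>b u. exp (- (2 * complex_of_real pi * \<i> * (u * (0 \<bullet> b)))) * exp (- pi * a * u\<^sup>2)"]
    by simp
  then show ?thesis by (simp add: complex_of_real_integrable_eq)
qed

lemma fourier_gauss:
  assumes a: "a > 0"
  shows "fourier_integral (\<lambda>x. complex_of_real (gauss a x)) \<xi> = complex_of_real (gauss (1/a) \<xi> / a)"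
proof -
  have "(norm \<xi>)\<^sup>2 = (\<Sum>b\<in>Basis. (\<xi> \<bullet> b)\<^sup>2)"
    unfolding power2_norm_eq_inner by (subst euclidean_inner) (simp add: power2_eq_square)
  then have g: "gauss (1/a) \<xi> = (\<Prod>b\<in>Basis. exp (- pi * (\<xi> \<bullet> b)\<^sup>2 / a))"
    unfolding gauss_def by (simp add: sum_distrib_left flip: exp_sum sum_negf sum_divide_distrib)
  have "fourier_integral (\<lambda>x. complex_of_real (gauss a x)) \<xi> =
    (\<Prod>b\<in>Basis. complex_of_real (exp (- pi * (\<xi> \<bullet> b)\<^sup>2 / a) / sqrt a))"
    unfolding fourier_integral_def fourier_gauss_integrand
    by (subst integral_lborel_prod_Basis[where F="\<lambda>b u. exp (- (2 * complex_of_real pi * \<i> * (u * (\<xi> \<bullet> b)))) * exp (- pi * a * u\<^sup>2)"])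
       (use integrable_gauss_real[OF a] integral_gauss_real[OF a] in auto)
  also have "\<dots> = complex_of_real (\<Prod>b\<in>(Basis::(real^2) set). exp (- pi * (\<xi> \<bullet> b)\<^sup>2 / a) / sqrt a)"
    by simp
  also have "(\<Prod>b\<in>(Basis::(real^2) set). exp (- pi * (\<xi> \<bullet> b)\<^sup>2 / a) / sqrt a) = gauss (1/a) \<xi> / a"
    unfolding prod_dividef g using a by simp
  finally show ?thesis .
qed

lemma integral_gauss:
  assumes a: "a > 0"
  shows "(LINT x|lborel. gauss a x) = 1 / a"
proof -
  have "complex_of_real (LINT x|lborel. gauss a x) = fourier_integral (\<lambda>x. complex_of_real (gauss a x)) 0"
    unfolding fourier_integral_def by simp
  also have "\<dots> = complex_of_real (1 / a)" unfolding fourier_gauss[OF a] by (simp add: gauss_def)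
  finally show ?thesis by (simp only: of_real_eq_iff)
qed

lemma nn_integral_gauss: "a > 0 \<Longrightarrow> (\<integral>\<^sup>+x. ennreal (gauss a x) \<partial>lborel) = ennreal (1 / a)"
  by (subst nn_integral_eq_integral) (auto simp: integral_gauss)

section \<open>The Plancherel identity\<close>

definition phase :: "real \<Rightarrow> complex" where
  "phase t = exp (- (2 * complex_of_real pi * \<i> * complex_of_real t))"

lemma phase_add: "phase (s + t) = phase s * phase t"
  by (simp add: phase_def exp_add[symmetric] algebra_simps)

lemma cnj_phase: "cnj (phase t) = phase (- t)"
  by (simp add: phase_def exp_cnj)

lemma norm_phase [simp]: "norm (phase t) = 1"
  by (simp add: phase_def norm_exp_eq_Re)

lemma phase_measurable [measurable]: "phase \<in> borel_measurable borel"
  unfolding phase_def by measurable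

lemma fourier_integral_phase: "fourier_integral f \<xi> = (LINT x|lborel. phase (x \<bullet> \<xi>) * f x)"
  by (simp add: fourier_integral_def phase_def)

lemma integrable_phase_mult [simp]:
  fixes h :: "'a \<Rightarrow> real"
  assumes "integrable M f" and [measurable]: "h \<in> borel_measurable M"
  shows "integrable M (\<lambda>x. phase (h x) * f x)"
proof (rule Bochner_Integration.integrable_bound[OF assms(1)])
  have [measurable]: "f \<in> borel_measurable M" using assms(1) by simp
  show "(\<lambda>x. phase (h x) * f x) \<in> borel_measurable M" by measurable
qed (simp add: norm_mult)

lemma fourier_integral_measurable [measurable]:
  assumes [measurable]: "f \<in> borel_measurable borel"
  shows "fourier_integral f \<in> borel_measurable borel"
  unfolding fourier_integral_phase by measurable

lemma norm_fourier_integral_le: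
  assumes "integrable lborel f"
  shows "norm (fourier_integral f \<xi>) \<le> (LINT x|lborel. norm (f x))"
  unfolding fourier_integral_phase
  by (rule order_trans[OF integral_norm_bound]) (simp add: norm_mult)

lemma fourier_integral_diff:
  assumes "integrable lborel f" "integrable lborel g"
  shows "fourier_integral (\<lambda>x. f x - g x) \<xi> = fourier_integral f \<xi> - fourier_integral g \<xi>"
  unfolding fourier_integral_phase using assms by (simp add: right_diff_distrib)

lemma fourier_integral_modulate:
  "fourier_integral (\<lambda>x. phase (- (x \<bullet> \<eta>)) * f x) \<xi> = fourier_integral f (\<xi> - \<eta>)"
  unfolding fourier_integral_phase by (simp flip: mult.assoc phase_add add: inner_diff_right)

lemma fourier_integral_translate:
  assumes [measurable]: "f \<in> borel_measurable borel"
  shows "fourier_integral (\<lambda>x. f (x - y)) \<xi> = phase (y \<bullet> \<xi>) * fourier_integral f \<xi>"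
proof -
  have "fourier_integral (\<lambda>x. f (x - y)) \<xi> = (LINT x|lborel. (\<lambda>x. phase (y \<bullet> \<xi>) * (phase (x \<bullet> \<xi>) * f x)) (x - y))"
    unfolding fourier_integral_phase
    by (intro Bochner_Integration.integral_cong) (auto simp flip: mult.assoc phase_add simp: inner_diff_left)
  also have "\<dots> = phase (y \<bullet> \<xi>) * fourier_integral f \<xi>"
    unfolding fourier_integral_phase by (subst integral_lborel_translate) auto
  finally show ?thesis .
qed

lemma fourier_multiplication_formula:
  assumes f: "integrable lborel f" and k: "integrable lborel k"
  shows "(LINT \<xi>|lborel. fourier_integral f \<xi> * k \<xi>) = (LINT x|lborel. f x * fourier_integral k x)"
proof -
  have [measurable]: "f \<in> borel_measurable borel" "k \<in> borel_measurable borel"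
    using f k borel_measurable_integrable by auto
  have int: "integrable (lborel \<Otimes>\<^sub>M lborel) (\<lambda>(x, \<xi>). phase (x \<bullet> \<xi>) * f x * k \<xi>)"
  proof (rule lborel_pair.Fubini_integrable)
    show "(\<lambda>(x, \<xi>). phase (x \<bullet> \<xi>) * f x * k \<xi>) \<in> borel_measurable (lborel \<Otimes>\<^sub>M lborel)"
      by measurable
    show "integrable lborel (\<lambda>x. LINT \<xi>|lborel. norm (case (x, \<xi>) of (x, \<xi>) \<Rightarrow> phase (x \<bullet> \<xi>) * f x * k \<xi>))"
      using f by (simp add: norm_mult)
    show "AE x in lborel. integrable lborel (\<lambda>\<xi>. case (x, \<xi>) of (x, \<xi>) \<Rightarrow> phase (x \<bullet> \<xi>) * f x * k \<xi>)"
    proof (rule AE_I2)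
      fix x
      have "integrable lborel (\<lambda>\<xi>. phase (x \<bullet> \<xi>) * (f x * k \<xi>))"
        using k by (intro integrable_phase_mult) auto
      then show "integrable lborel (\<lambda>\<xi>. case (x, \<xi>) of (x, \<xi>) \<Rightarrow> phase (x \<bullet> \<xi>) * f x * k \<xi>)"
        by (simp add: mult.assoc)
    qed
  qed
  have "(LINT \<xi>|lborel. fourier_integral f \<xi> * k \<xi>) = (LINT \<xi>|lborel. LINT x|lborel. phase (x \<bullet> \<xi>) * f x * k \<xi>)"
    unfolding fourier_integral_phase by simp
  also have "\<dots> = (LINT x|lborel. LINT \<xi>|lborel. phase (x \<bullet> \<xi>) * f x * k \<xi>)"
    by (rule lborel_pair.Fubini_integral[OF int])
  also have "\<dots> = (LINT x|lborel. LINT \<xi>|lborel. f x * (phase (\<xi> \<bullet> x) * k \<xi>))"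
    by (simp add: inner_commute ac_simps)
  also have "\<dots> = (LINT x|lborel. f x * fourier_integral k x)"
    unfolding fourier_integral_phase by simp
  finally show ?thesis .
qed

lemma cnj_measurable [measurable]: "cnj \<in> borel_measurable borel"
  by (intro borel_measurable_continuous_onI continuous_on_cnj continuous_on_id)

text \<open>
  Multiplying the transform of \<open>f\<close> by a Gaussian of width \<open>1/a\<close> and transforming back averages \<open>f\<close> over
  Gaussian displacements of size \<open>a\<close>.  Putting the displacement into the argument of \<open>f\<close> keeps the
  averaging measure independent of \<open>a\<close>, so that a later limit in \<open>a\<close> is a dominated one.
\<close>

lemma gaussian_average_identity:
  assumes f: "integrable lborel f" and a: "a > 0"
  defines "K \<equiv> \<lambda>\<xi>. cnj (fourier_integral f \<xi>) * complex_of_real (gauss (a\<^sup>2) \<xi>)"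
  shows "integrable lborel K"
    and "cnj (fourier_integral K x) = (LINT u|lborel. f (x + a *\<^sub>R u) * complex_of_real (gauss 1 u))"
proof -
  have [measurable]: "f \<in> borel_measurable borel" using f by simp
  have g: "integrable lborel (\<lambda>\<xi>. complex_of_real (gauss (a\<^sup>2) \<xi>))"
    using a by (intro integrable_of_real gauss_integrable) auto
  show "integrable lborel K"
  proof (rule Bochner_Integration.integrable_bound)
    show "integrable lborel (\<lambda>\<xi>. (LINT x|lborel. norm (f x)) * gauss (a\<^sup>2) \<xi>)"
      using a by simp
    show "K \<in> borel_measurable lborel" unfolding K_def by measurable
    show "AE \<xi> in lborel. norm (K \<xi>) \<le> norm ((LINT x|lborel. norm (f x)) * gauss (a\<^sup>2) \<xi>)"
      using norm_fourier_integral_le[OF f]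
      by (auto simp: K_def norm_mult abs_mult intro!: mult_right_mono AE_I2 order_trans[OF _ abs_ge_self])
  qed
  \<comment> \<open>The modulated Gaussian whose transform is a Gaussian kernel centred at \<open>x\<close>.\<close>
  let ?m = "\<lambda>\<xi>. phase (- (\<xi> \<bullet> x)) * complex_of_real (gauss (a\<^sup>2) \<xi>)"
  have m: "integrable lborel ?m" by (intro integrable_phase_mult g) auto
  have "cnj (fourier_integral K x) = (LINT \<xi>|lborel. cnj (phase (\<xi> \<bullet> x) * K \<xi>))"
    unfolding fourier_integral_phase by (rule Bochner_Integration.integral_cnj[symmetric])
  also have "\<dots> = (LINT \<xi>|lborel. fourier_integral f \<xi> * ?m \<xi>)"
    by (simp add: K_def cnj_phase ac_simps)
  also have "\<dots> = (LINT y|lborel. f y * fourier_integral ?m y)"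
    by (rule fourier_multiplication_formula[OF f m])
  also have "\<dots> = (LINT y|lborel. f y * complex_of_real (gauss (1/a\<^sup>2) (y - x) / a\<^sup>2))"
    unfolding fourier_integral_modulate using a by (simp add: fourier_gauss)
  also have "\<dots> = a\<^sup>2 *\<^sub>R (LINT u|lborel. f (x + a *\<^sub>R u) * complex_of_real (gauss (1/a\<^sup>2) (x + a *\<^sub>R u - x) / a\<^sup>2))"
    by (subst integral_lborel_affine[OF a, of _ x]) auto
  also have "\<dots> = (LINT u|lborel. f (x + a *\<^sub>R u) * complex_of_real (gauss 1 u))"
  proof -
    have "gauss (1/a\<^sup>2) (a *\<^sub>R u) = gauss 1 u" for u
      using a by (simp add: gauss_def power_mult_distrib)
    then have "(LINT u|lborel. f (x + a *\<^sub>R u) * complex_of_real (gauss (1/a\<^sup>2) (x + a *\<^sub>R u - x) / a\<^sup>2))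
      = (LINT u|lborel. f (x + a *\<^sub>R u) * complex_of_real (gauss 1 u)) / complex_of_real (a\<^sup>2)"
      by simp
    then show ?thesis using a by (simp add: scaleR_conv_of_real)
  qed
  finally show "cnj (fourier_integral K x) = (LINT u|lborel. f (x + a *\<^sub>R u) * complex_of_real (gauss 1 u))" .
qed

lemma gauss_le_1: "a \<ge> 0 \<Longrightarrow> gauss a x \<le> 1"
  by (simp add: gauss_def)

text \<open>
  By the multiplication formula the first integral is the integral of \<open>Re (f(x) cnj (f(x + a u)))\<close>
  against the Gaussian in \<open>u\<close>, and twice this real part is
  \<open>|f(x)|\<^sup>2 + |f(x + a u)|\<^sup>2 - |f(x + a u) - f(x)|\<^sup>2\<close>.
\<close>

lemma gaussian_energy_identity:
  assumes f: "integrable lborel f" and fin: "energy f < \<infinity>" and a: "a > 0"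
  shows "2 * (\<integral>\<^sup>+\<xi>. ennreal ((norm (fourier_integral f \<xi>))\<^sup>2) * ennreal (gauss (a\<^sup>2) \<xi>) \<partial>lborel)
     + (\<integral>\<^sup>+u. ennreal (gauss 1 u) * energy (\<lambda>x. f (x - (- a) *\<^sub>R u) - f x) \<partial>lborel) = 2 * energy f"
proof -
  have fm [measurable]: "f \<in> borel_measurable borel" using f by simp
  define F where "F = fourier_integral f"
  define K where "K = (\<lambda>\<xi>. cnj (F \<xi>) * complex_of_real (gauss (a\<^sup>2) \<xi>))"
  define A where "A = (\<lambda>x. LINT u|lborel. f (x + a *\<^sub>R u) * complex_of_real (gauss 1 u))"
  define N where "N = (LINT x|lborel. (norm (f x))\<^sup>2)"
  \<comment> \<open>Integrating the pointwise polarisation identity over \<open>u\<close> gives \<open>r = |f|\<^sup>2 + q - 2 c\<close>.\<close>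
  define c where "c = (\<lambda>x. Re (f x * cnj (A x)))"
  define q where "q = (\<lambda>x. LINT u|lborel. (norm (f (x + a *\<^sub>R u)))\<^sup>2 * gauss 1 u)"
  define r where "r = (\<lambda>x. LINT u|lborel. (norm (f (x + a *\<^sub>R u) - f x))\<^sup>2 * gauss 1 u)"
  have Fm [measurable]: "F \<in> borel_measurable borel" unfolding F_def by measurable
  have K: "integrable lborel K" and KA: "cnj (fourier_integral K x) = A x" for x
    unfolding K_def F_def A_def using gaussian_average_identity[OF f a] by auto
  have EN: "energy f = ennreal N" unfolding N_def by (rule energy_eq_integral[OF fm fin])
  have N0: "N \<ge> 0" by (simp add: N_def)
  have sq: "integrable lborel (\<lambda>x. (norm (f x))\<^sup>2)" using energy_finite_iff[OF fm] fin by simp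
  have Am [measurable]: "A \<in> borel_measurable borel" unfolding A_def by measurable
  have fA: "integrable lborel (\<lambda>x. f x * cnj (A x))"
  proof (rule Bochner_Integration.integrable_bound)
    show "integrable lborel (\<lambda>x. norm (f x) * (LINT \<xi>|lborel. norm (K \<xi>)))" using f by simp
    show "AE x in lborel. norm (f x * cnj (A x)) \<le> norm (norm (f x) * (LINT \<xi>|lborel. norm (K \<xi>)))"
      using norm_fourier_integral_le[OF K]
      by (auto simp: norm_mult abs_mult simp flip: KA intro!: mult_left_mono AE_I2 order_trans[OF _ abs_ge_self])
  qed measurable
  have c_int: "integrable lborel c" unfolding c_def using fA by (rule integrable_Re)
  have FK: "F \<xi> * K \<xi> = complex_of_real ((norm (F \<xi>))\<^sup>2 * gauss (a\<^sup>2) \<xi>)" for \<xi>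
    unfolding K_def of_real_mult complex_norm_square by (simp add: mult.assoc)
  have "integrable lborel (\<lambda>\<xi>. F \<xi> * K \<xi>)"
  proof (rule Bochner_Integration.integrable_bound)
    show "integrable lborel (\<lambda>\<xi>. (LINT x|lborel. norm (f x)) * norm (K \<xi>))" using K by simp
    show "(\<lambda>\<xi>. F \<xi> * K \<xi>) \<in> borel_measurable lborel" unfolding K_def by measurable
    show "AE \<xi> in lborel. norm (F \<xi> * K \<xi>) \<le> norm ((LINT x|lborel. norm (f x)) * norm (K \<xi>))"
      using norm_fourier_integral_le[OF f]
      by (auto simp: norm_mult abs_mult F_def intro!: mult_right_mono AE_I2 order_trans[OF _ abs_ge_self])
  qed
  then have L_int: "integrable lborel (\<lambda>\<xi>. (norm (F \<xi>))\<^sup>2 * gauss (a\<^sup>2) \<xi>)"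
    unfolding FK by (simp only: complex_of_real_integrable_eq)
  have "complex_of_real (LINT \<xi>|lborel. (norm (F \<xi>))\<^sup>2 * gauss (a\<^sup>2) \<xi>) = (LINT \<xi>|lborel. F \<xi> * K \<xi>)"
    unfolding FK by (rule integral_complex_of_real[symmetric])
  also have "\<dots> = (LINT x|lborel. f x * fourier_integral K x)"
    unfolding F_def by (rule fourier_multiplication_formula[OF f K])
  also have "\<dots> = (LINT x|lborel. f x * cnj (A x))" by (simp flip: KA)
  finally have "(LINT \<xi>|lborel. (norm (F \<xi>))\<^sup>2 * gauss (a\<^sup>2) \<xi>) = Re (LINT x|lborel. f x * cnj (A x))"
    by (metis Re_complex_of_real)
  then have Lc: "(LINT \<xi>|lborel. (norm (F \<xi>))\<^sup>2 * gauss (a\<^sup>2) \<xi>) = integral\<^sup>L lborel c"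
    unfolding c_def by (simp only: integral_Re[OF fA])
  have fu: "integrable lborel (\<lambda>u. f (x + a *\<^sub>R u) * complex_of_real (gauss 1 u))" for x
  proof (rule Bochner_Integration.integrable_bound[OF integrable_lborel_affine[OF a f, of x]])
    show "AE u in lborel. norm (f (x + a *\<^sub>R u) * complex_of_real (gauss 1 u)) \<le> norm (f (x + a *\<^sub>R u))"
      by (auto simp: norm_mult gauss_le_1 intro!: AE_I2 mult_left_le)
  qed measurable
  have qu: "integrable lborel (\<lambda>u. (norm (f (x + a *\<^sub>R u)))\<^sup>2 * gauss 1 u)" for x
  proof (rule Bochner_Integration.integrable_bound[OF integrable_lborel_affine[OF a sq, of x]])
    show "AE u in lborel. norm ((norm (f (x + a *\<^sub>R u)))\<^sup>2 * gauss 1 u) \<le> norm ((norm (f (x + a *\<^sub>R u)))\<^sup>2)"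
      by (auto simp: norm_mult gauss_le_1 intro!: AE_I2 mult_left_le)
  qed measurable
  have pointwise: "(norm (f (x + a *\<^sub>R u) - f x))\<^sup>2 * gauss 1 u =
      (norm (f x))\<^sup>2 * gauss 1 u + (norm (f (x + a *\<^sub>R u)))\<^sup>2 * gauss 1 u
      - 2 * Re (f x * cnj (f (x + a *\<^sub>R u) * complex_of_real (gauss 1 u)))" for x u
    unfolding cmod_power2 by (simp add: power2_eq_square algebra_simps)
  have cu: "integrable lborel (\<lambda>u. f x * cnj (f (x + a *\<^sub>R u) * complex_of_real (gauss 1 u)))" for x
    by (intro integrable_mult_right integrable_cnj fu)
  have c_eq: "c x = (LINT u|lborel. Re (f x * cnj (f (x + a *\<^sub>R u) * complex_of_real (gauss 1 u))))" for x
    unfolding c_def A_def using integral_Re[OF cu[of x]] fu[of x] by (simp del: complex_cnj_mult)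
  have ru: "integrable lborel (\<lambda>u. (norm (f (x + a *\<^sub>R u) - f x))\<^sup>2 * gauss 1 u)" for x
    unfolding pointwise
    by (intro Bochner_Integration.integrable_diff Bochner_Integration.integrable_add integrable_mult_right qu integrable_Re cu) simp
  have lin: "(LINT u|lborel. p * gauss 1 u + Q u - 2 * R u) = p + integral\<^sup>L lborel Q - 2 * integral\<^sup>L lborel R"
    if "integrable lborel Q" "integrable lborel R" for p :: real and Q R
    using that by (simp add: integral_gauss)
  have r_eq: "r x = (norm (f x))\<^sup>2 + q x - 2 * c x" for x
    unfolding r_def pointwise c_eq q_def by (rule lin[OF qu integrable_Re[OF cu]])
  have fub: "(\<integral>\<^sup>+x. ennreal (LINT u|lborel. h x u * gauss 1 u) \<partial>lborel) =
      (\<integral>\<^sup>+u. ennreal (gauss 1 u) * (\<integral>\<^sup>+x. ennreal (h x u) \<partial>lborel) \<partial>lborel)"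
    if [measurable]: "case_prod h \<in> borel_measurable (lborel \<Otimes>\<^sub>M lborel)" and h0: "\<And>x u. 0 \<le> h x u"
      and hi: "\<And>x. integrable lborel (\<lambda>u. h x u * gauss 1 u)" for h :: "real^2 \<Rightarrow> real^2 \<Rightarrow> real"
  proof -
    have "(\<integral>\<^sup>+x. ennreal (LINT u|lborel. h x u * gauss 1 u) \<partial>lborel) =
      (\<integral>\<^sup>+x. \<integral>\<^sup>+u. ennreal (h x u) * ennreal (gauss 1 u) \<partial>lborel \<partial>lborel)"
      using h0 hi by (intro nn_integral_cong, subst nn_integral_eq_integral[symmetric]) (auto simp: ennreal_mult')
    also have "\<dots> = (\<integral>\<^sup>+u. \<integral>\<^sup>+x. ennreal (h x u) * ennreal (gauss 1 u) \<partial>lborel \<partial>lborel)"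
      by (rule lborel_pair.Fubini'[symmetric]) measurable
    also have "\<dots> = (\<integral>\<^sup>+u. ennreal (gauss 1 u) * (\<integral>\<^sup>+x. ennreal (h x u) \<partial>lborel) \<partial>lborel)"
    proof (intro nn_integral_cong)
      fix u
      have "(\<lambda>x. case_prod h (x, u)) \<in> borel_measurable lborel" by measurable
      then show "(\<integral>\<^sup>+x. ennreal (h x u) * ennreal (gauss 1 u) \<partial>lborel) = ennreal (gauss 1 u) * (\<integral>\<^sup>+x. ennreal (h x u) \<partial>lborel)"
        by (subst nn_integral_multc) (simp_all add: mult.commute)
    qed
    finally show ?thesis .
  qed
  have tr: "energy (\<lambda>x. f (x + a *\<^sub>R u)) = energy f" for u
    using energy_translate[OF fm, of "- a *\<^sub>R u"] by simp
  have "(\<integral>\<^sup>+x. ennreal (q x) \<partial>lborel) = (\<integral>\<^sup>+u. ennreal (gauss 1 u) * energy (\<lambda>x. f (x + a *\<^sub>R u)) \<partial>lborel)"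
    unfolding q_def energy_def by (rule fub[where h="\<lambda>x u. (norm (f (x + a *\<^sub>R u)))\<^sup>2"]) (use qu in auto)
  also have "\<dots> = ennreal N"
    unfolding tr by (simp add: nn_integral_multc nn_integral_gauss EN)
  finally have q_nn: "(\<integral>\<^sup>+x. ennreal (q x) \<partial>lborel) = ennreal N" .
  have q0: "q x \<ge> 0" for x unfolding q_def by simp
  have [measurable]: "q \<in> borel_measurable borel" unfolding q_def by measurable
  have q_int: "integrable lborel q" and q_val: "integral\<^sup>L lborel q = N"
    using nn_integral_eq_integrable[of q lborel N] q_nn q0 N0 by auto
  have r_int: "integrable lborel r" and r_val: "integral\<^sup>L lborel r = 2 * N - 2 * integral\<^sup>L lborel c"
    unfolding r_eq[abs_def] using sq q_int c_int q_val by (auto simp: N_def)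
  have r0: "r x \<ge> 0" for x unfolding r_def by simp
  have "(\<integral>\<^sup>+u. ennreal (gauss 1 u) * energy (\<lambda>x. f (x - (- a) *\<^sub>R u) - f x) \<partial>lborel) = (\<integral>\<^sup>+x. ennreal (r x) \<partial>lborel)"
    unfolding r_def energy_def using fub[of "\<lambda>x u. (norm (f (x + a *\<^sub>R u) - f x))\<^sup>2"] ru by simp
  also have "\<dots> = ennreal (integral\<^sup>L lborel r)" using r_int r0 by (intro nn_integral_eq_integral) auto
  finally have R: "(\<integral>\<^sup>+u. ennreal (gauss 1 u) * energy (\<lambda>x. f (x - (- a) *\<^sub>R u) - f x) \<partial>lborel) = ennreal (integral\<^sup>L lborel r)" .
  have L: "(\<integral>\<^sup>+\<xi>. ennreal ((norm (F \<xi>))\<^sup>2) * ennreal (gauss (a\<^sup>2) \<xi>) \<partial>lborel) = ennreal (integral\<^sup>L lborel c)"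
    unfolding Lc[symmetric] using L_int by (subst nn_integral_eq_integral[symmetric]) (auto simp: ennreal_mult')
  have c0: "0 \<le> integral\<^sup>L lborel c" unfolding Lc[symmetric] by simp
  have rr: "0 \<le> integral\<^sup>L lborel r" using r0 by simp
  have "2 * ennreal (integral\<^sup>L lborel c) + ennreal (integral\<^sup>L lborel r) = ennreal (2 * integral\<^sup>L lborel c + integral\<^sup>L lborel r)"
    using c0 rr by (simp add: ennreal_mult')
  also have "\<dots> = 2 * ennreal N" unfolding r_val using N0 by (simp add: ennreal_mult')
  finally show ?thesis unfolding R EN F_def[symmetric] L .
qed

text \<open>
  As \<open>a \<rightarrow> 0\<close> in the preceding identity, the first integral increases to the energy of the
  transform and the second one tends to zero.
\<close>

theorem plancherel:
  assumes f: "integrable lborel f" and fin: "energy f < \<infinity>"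
  shows "energy (fourier_integral f) = energy f"
proof -
  have fm [measurable]: "f \<in> borel_measurable borel" using f by simp
  define F where "F = fourier_integral f"
  have Fm [measurable]: "F \<in> borel_measurable borel" unfolding F_def by measurable
  define a where "a n = 1 / real (Suc n)" for n
  have a: "a n > 0" for n by (simp add: a_def)
  have a0: "a \<longlonglongrightarrow> 0" unfolding a_def[abs_def] by (rule LIMSEQ_Suc[OF lim_1_over_n])
  have adec: "a n \<le> a m" if "m \<le> n" for m n using that by (simp add: a_def frac_le)
  define L where "L n = (\<integral>\<^sup>+\<xi>. ennreal ((norm (F \<xi>))\<^sup>2) * ennreal (gauss ((a n)\<^sup>2) \<xi>) \<partial>lborel)" for n
  define S where "S n = (\<integral>\<^sup>+u. ennreal (gauss 1 u) * energy (\<lambda>x. f (x - (- a n) *\<^sub>R u) - f x) \<partial>lborel)" for n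
  have id: "2 * L n + S n = 2 * energy f" for n
    unfolding L_def S_def F_def by (rule gaussian_energy_identity[OF f fin a])
  have "L \<longlonglongrightarrow> energy F"
    unfolding L_def[abs_def] energy_def
  proof (rule nn_integral_LIMSEQ)
    show "incseq (\<lambda>n \<xi>. ennreal ((norm (F \<xi>))\<^sup>2) * ennreal (gauss ((a n)\<^sup>2) \<xi>))"
    proof (intro incseq_SucI le_funI mult_left_mono ennreal_leI)
      fix n and x :: "real^2"
      have "(a (Suc n))\<^sup>2 \<le> (a n)\<^sup>2" using a[of "Suc n"] by (intro power_mono adec) auto
      then have "(a (Suc n))\<^sup>2 * (norm x)\<^sup>2 \<le> (a n)\<^sup>2 * (norm x)\<^sup>2" by (intro mult_right_mono) auto
      then show "gauss ((a n)\<^sup>2) x \<le> gauss ((a (Suc n))\<^sup>2) x"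
        unfolding gauss_def by (simp add: mult.assoc)
    qed simp
    fix \<xi>
    have "(\<lambda>n. gauss ((a n)\<^sup>2) \<xi>) \<longlonglongrightarrow> exp (- pi * 0\<^sup>2 * (norm \<xi>)\<^sup>2)"
      unfolding gauss_def by (intro tendsto_intros a0)
    then have "(\<lambda>n. ennreal ((norm (F \<xi>))\<^sup>2 * gauss ((a n)\<^sup>2) \<xi>)) \<longlonglongrightarrow> ennreal ((norm (F \<xi>))\<^sup>2 * 1)"
      by (intro tendsto_ennrealI tendsto_mult tendsto_const) simp
    then show "(\<lambda>n. ennreal ((norm (F \<xi>))\<^sup>2) * ennreal (gauss ((a n)\<^sup>2) \<xi>)) \<longlonglongrightarrow> ennreal ((norm (F \<xi>))\<^sup>2)"
      by (simp add: ennreal_mult')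
  qed measurable
  moreover have "S \<longlonglongrightarrow> (\<integral>\<^sup>+u. 0 \<partial>(lborel :: (real^2) measure))"
    unfolding S_def[abs_def]
  proof (rule nn_integral_dominated_convergence[where w="\<lambda>u. ennreal (gauss 1 u) * (4 * energy f)"])
    show "(\<lambda>u. ennreal (gauss 1 u) * energy (\<lambda>x. f (x - (- a n) *\<^sub>R u) - f x)) \<in> borel_measurable lborel" for n
      unfolding energy_def by measurable
    show "AE u in lborel. ennreal (gauss 1 u) * energy (\<lambda>x. f (x - (- a n) *\<^sub>R u) - f x) \<le> ennreal (gauss 1 u) * (4 * energy f)" for n
    proof (intro AE_I2 mult_left_mono)
      fix u
      have "energy (\<lambda>x. f (x - (- a n) *\<^sub>R u) - f x) \<le> 2 * energy (\<lambda>x. f (x - (- a n) *\<^sub>R u)) + 2 * energy f"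
        by (rule energy_diff_le) measurable
      also have "\<dots> = 4 * energy f" unfolding energy_translate[OF fm] by (simp flip: distrib_right)
      finally show "energy (\<lambda>x. f (x - (- a n) *\<^sub>R u) - f x) \<le> 4 * energy f" .
    qed simp
    show "(\<integral>\<^sup>+u. ennreal (gauss 1 u) * (4 * energy f) \<partial>lborel) < \<infinity>"
      using fin by (simp add: nn_integral_multc nn_integral_gauss ennreal_mult_less_top)
    show "AE u in lborel. (\<lambda>n. ennreal (gauss 1 u) * energy (\<lambda>x. f (x - (- a n) *\<^sub>R u) - f x)) \<longlonglongrightarrow> 0"
    proof (rule AE_I2)
      fix u :: "real^2"
      have "(\<lambda>n. (- a n) *\<^sub>R u) \<longlonglongrightarrow> (- 0) *\<^sub>R u" by (intro tendsto_intros a0)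
      then have "(\<lambda>n. energy (\<lambda>x. f (x - (- a n) *\<^sub>R u) - f x)) \<longlonglongrightarrow> 0"
        by (intro energy_translation_tendsto fin) auto
      from ennreal_tendsto_cmult[OF _ this, of "ennreal (gauss 1 u)"]
      show "(\<lambda>n. ennreal (gauss 1 u) * energy (\<lambda>x. f (x - (- a n) *\<^sub>R u) - f x)) \<longlonglongrightarrow> 0" by simp
    qed
  qed measurable
  ultimately have "(\<lambda>n. 2 * L n + S n) \<longlonglongrightarrow> 2 * energy F + 0"
    by (intro tendsto_add ennreal_tendsto_cmult) auto
  then have "2 * energy F = 2 * energy f" unfolding id by (simp add: LIMSEQ_const_iff)
  then show ?thesis unfolding F_def by (simp add: ennreal_mult_cancel_left)
qed

section \<open>The Fourier transform on square integrable functions\<close>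

text \<open>
  The truncations through which the Fourier transform on \<open>L\<^sup>2\<close> is defined.
\<close>

definition trunc :: "nat \<Rightarrow> (real^2 \<Rightarrow> complex) \<Rightarrow> real^2 \<Rightarrow> complex" where
  "trunc n f x = indicator (cball 0 (real n)) x * f x"

lemma trunc_measurable [measurable]: "f \<in> borel_measurable borel \<Longrightarrow> trunc n f \<in> borel_measurable borel"
  unfolding trunc_def[abs_def] by (intro borel_measurable_times borel_measurable_indicator) auto

lemma trunc_L2:
  assumes "f \<in> L2" shows "trunc n f \<in> L2"
proof -
  have [measurable]: "f \<in> borel_measurable borel" using assms by (simp add: L2_iff_energy)
  have "energy (trunc n f) \<le> energy f"
    unfolding energy_def trunc_def by (intro nn_integral_mono) (auto split: split_indicator)
  then show ?thesis using assms by (auto simp: L2_iff_energy)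
qed

lemma trunc_integrable:
  assumes "f \<in> L2" shows "integrable lborel (trunc n f)"
proof (rule Bochner_Integration.integrable_bound)
  have [measurable]: "f \<in> borel_measurable borel" using assms by (simp add: L2_iff_energy)
  show "integrable lborel (\<lambda>x. indicator (cball 0 (real n)) x + (norm (f x))\<^sup>2)"
    using assms
    by (intro Bochner_Integration.integrable_add integrable_real_indicator)
       (auto simp: L2_def emeasure_lborel_cball_finite[unfolded infinity_ennreal_def])
  show "trunc n f \<in> borel_measurable lborel" by measurable
  have "t \<le> 1 + t\<^sup>2" for t :: real
    using zero_le_power2[of "t - 1/2"] by (simp add: power2_eq_square algebra_simps)
  then show "AE x in lborel. norm (trunc n f x) \<le> norm (indicator (cball 0 (real n)) x + (norm (f x))\<^sup>2)"
    by (auto simp: trunc_def split: split_indicator)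
qed

lemma trunc_tendsto:
  assumes "f \<in> L2" shows "(\<lambda>n. energy (\<lambda>x. trunc n f x - f x)) \<longlonglongrightarrow> 0"
proof -
  have [measurable]: "f \<in> borel_measurable borel" using assms by (simp add: L2_iff_energy)
  have "(\<lambda>n. energy (\<lambda>x. trunc n f x - f x)) \<longlonglongrightarrow> (\<integral>\<^sup>+x. 0 \<partial>(lborel :: (real^2) measure))"
    unfolding energy_def
  proof (rule nn_integral_dominated_convergence[where w="\<lambda>x. ennreal ((norm (f x))\<^sup>2)"])
    show "AE x in lborel. (\<lambda>n. ennreal ((norm (trunc n f x - f x))\<^sup>2)) \<longlonglongrightarrow> 0"
    proof (rule AE_I2)
      fix x :: "real^2"
      obtain M where M: "norm x \<le> real M" using real_arch_simple by blast
      have "eventually (\<lambda>n. ennreal ((norm (trunc n f x - f x))\<^sup>2) = 0) sequentially"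
        using eventually_ge_at_top[of M]
      proof eventually_elim
        case (elim n)
        then have "norm x \<le> real n" using M by linarith
        then show ?case by (simp add: trunc_def)
      qed
      then show "(\<lambda>n. ennreal ((norm (trunc n f x - f x))\<^sup>2)) \<longlonglongrightarrow> 0" by (rule tendsto_eventually)
    qed
    show "(\<integral>\<^sup>+x. ennreal ((norm (f x))\<^sup>2) \<partial>lborel) < \<infinity>"
      using assms by (simp add: L2_iff_energy energy_def)
    show "AE x in lborel. ennreal ((norm (trunc n f x - f x))\<^sup>2) \<le> ennreal ((norm (f x))\<^sup>2)" for n
      by (auto simp: trunc_def split: split_indicator)
  qed measurable
  then show ?thesis by simp
qed

text \<open>
  By Plancherel the transforms of the truncations form a Cauchy sequence, so completeness provides a
  limit and the choice operator in the definition of the transform has something to choose.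
\<close>

lemma fourier_L2_spec:
  assumes f: "f \<in> L2"
  shows "fourier_L2 f \<in> L2"
    and "(\<lambda>n. energy (\<lambda>\<xi>. fourier_integral (trunc n f) \<xi> - fourier_L2 f \<xi>)) \<longlonglongrightarrow> 0"
proof -
  have fm [measurable]: "f \<in> borel_measurable borel" using f by (simp add: L2_iff_energy)
  let ?F = "\<lambda>n. fourier_integral (trunc n f)"
  have [measurable]: "?F n \<in> borel_measurable borel" for n by measurable
  obtain g where g: "g \<in> borel_measurable borel" "(\<lambda>n. energy (\<lambda>\<xi>. ?F n \<xi> - g \<xi>)) \<longlonglongrightarrow> 0"
  proof (rule energy_complete[of ?F])
    fix e :: real assume e: "0 < e"
    have "eventually (\<lambda>n. energy (\<lambda>x. trunc n f x - f x) \<le> ennreal (e/4)) sequentially"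
      using e by (intro ennreal_tendsto_zeroD trunc_tendsto f) auto
    then obtain N where N: "\<And>n. n \<ge> N \<Longrightarrow> energy (\<lambda>x. trunc n f x - f x) \<le> ennreal (e/4)"
      by (auto simp: eventually_sequentially)
    have "energy (\<lambda>\<xi>. ?F m \<xi> - ?F n \<xi>) \<le> ennreal e" if "m \<ge> N" "n \<ge> N" for m n
    proof -
      have "energy (\<lambda>\<xi>. ?F m \<xi> - ?F n \<xi>) = energy (fourier_integral (\<lambda>x. trunc m f x - trunc n f x))"
        unfolding energy_def by (simp add: fourier_integral_diff[OF trunc_integrable trunc_integrable] f)
      also have "\<dots> = energy (\<lambda>x. trunc m f x - trunc n f x)"
        using L2_diff[OF trunc_L2[OF f] trunc_L2[OF f]]
        by (intro plancherel Bochner_Integration.integrable_diff trunc_integrable f) (auto simp: L2_iff_energy)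
      also have "\<dots> = energy (\<lambda>x. (trunc m f x - f x) - (trunc n f x - f x))" by simp
      also have "\<dots> \<le> 2 * energy (\<lambda>x. trunc m f x - f x) + 2 * energy (\<lambda>x. trunc n f x - f x)"
        by (rule energy_diff_le) measurable
      also have "\<dots> \<le> 2 * ennreal (e/4) + 2 * ennreal (e/4)"
        by (intro add_mono mult_left_mono N that) auto
      also have "\<dots> = ennreal e" using e by (simp flip: ennreal_plus ennreal_mult' ennreal_numeral)
      finally show ?thesis .
    qed
    then show "\<exists>N. \<forall>m\<ge>N. \<forall>n\<ge>N. energy (\<lambda>\<xi>. ?F m \<xi> - ?F n \<xi>) \<le> ennreal e" by blast
  qed auto
  have "g \<in> L2"
  proof -
    have "eventually (\<lambda>n. energy (\<lambda>\<xi>. ?F n \<xi> - g \<xi>) \<le> ennreal 1) sequentially"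
      by (intro ennreal_tendsto_zeroD g) auto
    then obtain n where n: "energy (\<lambda>\<xi>. ?F n \<xi> - g \<xi>) \<le> ennreal 1" by (auto simp: eventually_sequentially)
    have "energy (?F n) < \<infinity>"
      using plancherel[OF trunc_integrable[OF f]] trunc_L2[OF f] by (simp add: L2_iff_energy)
    then have "?F n \<in> L2" by (simp add: L2_iff_energy)
    moreover have "(\<lambda>\<xi>. ?F n \<xi> - g \<xi>) \<in> L2"
      using n g(1) by (auto simp: L2_iff_energy intro: le_less_trans)
    ultimately have "(\<lambda>\<xi>. ?F n \<xi> - (?F n \<xi> - g \<xi>)) \<in> L2" by (rule L2_diff)
    then show ?thesis by simp
  qed
  with g(2) have "\<exists>g. g \<in> L2 \<and> (\<lambda>n. energy (\<lambda>\<xi>. ?F n \<xi> - g \<xi>)) \<longlonglongrightarrow> 0" by blast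
  from someI_ex[OF this] show "fourier_L2 f \<in> L2"
    "(\<lambda>n. energy (\<lambda>\<xi>. fourier_integral (trunc n f) \<xi> - fourier_L2 f \<xi>)) \<longlonglongrightarrow> 0"
    unfolding fourier_L2_def energy_def trunc_def[abs_def] by auto
qed

lemma fourier_L2_eq_fourier_integral:
  assumes f: "f \<in> L2" and int: "integrable lborel f"
  shows "AE \<xi> in lborel. fourier_L2 f \<xi> = fourier_integral f \<xi>"
proof -
  have [measurable]: "f \<in> borel_measurable borel" "fourier_L2 f \<in> borel_measurable borel"
    using f fourier_L2_spec[OF f] by (auto simp: L2_iff_energy)
  let ?F = "\<lambda>n. fourier_integral (trunc n f)"
  have le: "energy (\<lambda>\<xi>. fourier_L2 f \<xi> - fourier_integral f \<xi>) \<le>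
     2 * energy (\<lambda>x. trunc n f x - f x) + 2 * energy (\<lambda>\<xi>. ?F n \<xi> - fourier_L2 f \<xi>)" for n
  proof -
    have "energy (\<lambda>\<xi>. fourier_L2 f \<xi> - fourier_integral f \<xi>) =
      energy (\<lambda>\<xi>. fourier_integral (\<lambda>x. trunc n f x - f x) \<xi> - (?F n \<xi> - fourier_L2 f \<xi>))"
      by (simp add: fourier_integral_diff[OF trunc_integrable int] f)
    also have "\<dots> \<le> 2 * energy (fourier_integral (\<lambda>x. trunc n f x - f x)) + 2 * energy (\<lambda>\<xi>. ?F n \<xi> - fourier_L2 f \<xi>)"
      by (rule energy_diff_le) measurable
    also have "energy (fourier_integral (\<lambda>x. trunc n f x - f x)) = energy (\<lambda>x. trunc n f x - f x)"
      using L2_diff[OF trunc_L2[OF f] f]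
      by (intro plancherel Bochner_Integration.integrable_diff trunc_integrable f int) (auto simp: L2_iff_energy)
    finally show ?thesis .
  qed
  have "(\<lambda>n. 2 * energy (\<lambda>x. trunc n f x - f x) + 2 * energy (\<lambda>\<xi>. ?F n \<xi> - fourier_L2 f \<xi>)) \<longlonglongrightarrow> 2 * 0 + 2 * 0"
    by (intro tendsto_add ennreal_tendsto_cmult trunc_tendsto fourier_L2_spec f) auto
  then have "energy (\<lambda>\<xi>. fourier_L2 f \<xi> - fourier_integral f \<xi>) \<le> 2 * 0 + 2 * 0"
    using le by (intro LIMSEQ_le_const) auto
  then have "(\<integral>\<^sup>+\<xi>. ennreal ((norm (fourier_L2 f \<xi> - fourier_integral f \<xi>))\<^sup>2) \<partial>lborel) = 0"
    by (simp add: energy_def)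
  then show ?thesis
    by (subst (asm) nn_integral_0_iff_AE) auto
qed

text \<open>
  Translation acts as multiplication by the phase on the transform of each truncation.  The factor
  \<open>4\<close> instead of an equality comes from passing to the limit with the inequality
  \<open>|a + b|\<^sup>2 \<le> 2|a|\<^sup>2 + 2|b|\<^sup>2\<close> on both sides.
\<close>

lemma translation_energy_le_fourier:
  assumes f: "f \<in> L2"
  shows "energy (\<lambda>x. f (x - y) - f x) \<le> 4 * energy (\<lambda>\<xi>. (phase (y \<bullet> \<xi>) - 1) * fourier_L2 f \<xi>)"
proof -
  have [measurable]: "f \<in> borel_measurable borel" "fourier_L2 f \<in> borel_measurable borel"
    using f fourier_L2_spec[OF f] by (auto simp: L2_iff_energy)
  let ?F = "\<lambda>n. fourier_integral (trunc n f)"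
  let ?X = "energy (\<lambda>\<xi>. (phase (y \<bullet> \<xi>) - 1) * fourier_L2 f \<xi>)"
  let ?d = "\<lambda>n. energy (\<lambda>x. trunc n f x - f x)" and ?D = "\<lambda>n. energy (\<lambda>\<xi>. ?F n \<xi> - fourier_L2 f \<xi>)"
  have le: "energy (\<lambda>x. f (x - y) - f x) \<le> 2 * (4 * ?d n) + 2 * (2 * ?X + 8 * ?D n)" for n
  proof -
    let ?t = "trunc n f"
    have tm [measurable]: "?t \<in> borel_measurable borel" by measurable
    have tint: "integrable lborel ?t" by (rule trunc_integrable[OF f])
    have "integrable (distr lborel borel (\<lambda>x. x - y)) ?t" using tint by (simp add: distr_lborel_diff_right)
    then have tint': "integrable lborel (\<lambda>x. ?t (x - y))" by (subst (asm) integrable_distr_eq) auto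
    have tL2: "?t \<in> L2" by (rule trunc_L2[OF f])
    then have tL2': "(\<lambda>x. ?t (x - y)) \<in> L2" using energy_translate[OF tm] by (auto simp: L2_iff_energy)
    have "energy (\<lambda>x. f (x - y) - f x) = energy (\<lambda>x. (?t (x - y) - ?t x) - ((?t (x - y) - f (x - y)) - (?t x - f x)))"
      by simp
    also have "\<dots> \<le> 2 * energy (\<lambda>x. ?t (x - y) - ?t x) + 2 * energy (\<lambda>x. (?t (x - y) - f (x - y)) - (?t x - f x))"
      by (rule energy_diff_le) measurable
    also have "energy (\<lambda>x. (?t (x - y) - f (x - y)) - (?t x - f x)) \<le> 2 * energy (\<lambda>x. ?t (x - y) - f (x - y)) + 2 * ?d n"
      by (rule energy_diff_le) measurable
    also have "energy (\<lambda>x. ?t (x - y) - f (x - y)) = ?d n"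
      by (rule energy_translate) measurable
    also have "2 * ?d n + 2 * ?d n = 4 * ?d n" by (simp flip: distrib_right)
    also have "energy (\<lambda>x. ?t (x - y) - ?t x) = energy (fourier_integral (\<lambda>x. ?t (x - y) - ?t x))"
      using L2_diff[OF tL2' tL2]
      by (intro plancherel[symmetric] Bochner_Integration.integrable_diff tint tint') (auto simp: L2_iff_energy)
    also have "\<dots> = energy (\<lambda>\<xi>. (phase (y \<bullet> \<xi>) - 1) * fourier_L2 f \<xi> + (phase (y \<bullet> \<xi>) - 1) * (?F n \<xi> - fourier_L2 f \<xi>))"
      unfolding energy_def by (simp add: fourier_integral_diff[OF tint' tint] fourier_integral_translate algebra_simps)
    also have "\<dots> \<le> 2 * ?X + 2 * energy (\<lambda>\<xi>. (phase (y \<bullet> \<xi>) - 1) * (?F n \<xi> - fourier_L2 f \<xi>))"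
      by (rule energy_add_le) measurable
    also have "energy (\<lambda>\<xi>. (phase (y \<bullet> \<xi>) - 1) * (?F n \<xi> - fourier_L2 f \<xi>)) \<le> 4 * ?D n"
    proof -
      have "norm (phase t - 1) \<le> 2" for t using norm_triangle_ineq4[of "phase t" 1] by simp
      then have "(norm (phase t - 1))\<^sup>2 \<le> 2\<^sup>2" for t by (intro power_mono) auto
      then have "(norm ((phase (y \<bullet> \<xi>) - 1) * (?F n \<xi> - fourier_L2 f \<xi>)))\<^sup>2 \<le> 4 * (norm (?F n \<xi> - fourier_L2 f \<xi>))\<^sup>2" for \<xi>
        by (auto simp: norm_mult power_mult_distrib intro!: mult_right_mono)
      then have "energy (\<lambda>\<xi>. (phase (y \<bullet> \<xi>) - 1) * (?F n \<xi> - fourier_L2 f \<xi>))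
          \<le> (\<integral>\<^sup>+\<xi>. 4 * ennreal ((norm (?F n \<xi> - fourier_L2 f \<xi>))\<^sup>2) \<partial>lborel)"
        unfolding energy_def by (intro nn_integral_mono) (auto simp flip: ennreal_mult' ennreal_numeral intro!: ennreal_leI)
      also have "\<dots> = 4 * ?D n" unfolding energy_def by (rule nn_integral_cmult) measurable
      finally show ?thesis .
    qed
    finally show ?thesis by (simp add: add_mono mult_left_mono mult.assoc[symmetric] add.commute)
  qed
  have "(\<lambda>n. 2 * (4 * ?d n) + 2 * (2 * ?X + 8 * ?D n)) \<longlonglongrightarrow> 2 * (4 * 0) + 2 * (2 * ?X + 8 * 0)"
    by (intro tendsto_add tendsto_const ennreal_tendsto_cmult trunc_tendsto fourier_L2_spec f) auto
  then have "energy (\<lambda>x. f (x - y) - f x) \<le> 2 * (4 * 0) + 2 * (2 * ?X + 8 * 0)"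
    using le by (intro LIMSEQ_le_const) auto
  then show ?thesis by (simp add: mult.assoc[symmetric])
qed

text \<open>
  For \<open>|t| \<le> 1\<close> the modulus is at most \<open>2\<pi>|t|\<close>, and \<open>t\<^sup>2\<close> increases when its exponent drops from \<open>1\<close> to
  \<open>m\<close>; for larger \<open>t\<close> the trivial bound \<open>2\<close> suffices.
\<close>

lemma phase_minus_one_le:
  assumes m: "0 < m" "m \<le> 1"
  shows "(norm (phase t - 1))\<^sup>2 \<le> 4 * pi\<^sup>2 * (t\<^sup>2) powr m"
proof (cases "t\<^sup>2 \<le> 1")
  case True
  have "phase t = iexp (- 2 * pi * t)" by (simp add: phase_def ac_simps)
  with iexp_approx1[of "- 2 * pi * t" 0] have "norm (phase t - 1) \<le> 2 * pi * \<bar>t\<bar>"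
    by (simp add: abs_mult)
  then have "(norm (phase t - 1))\<^sup>2 \<le> (2 * pi * \<bar>t\<bar>)\<^sup>2" by (intro power_mono) auto
  also have "\<dots> = 4 * pi\<^sup>2 * (t\<^sup>2) powr 1" by (simp add: power_mult_distrib)
  also have "\<dots> \<le> 4 * pi\<^sup>2 * (t\<^sup>2) powr m"
    using m True by (intro mult_left_mono powr_mono') auto
  finally show ?thesis .
next
  case False
  have "norm (phase t - 1) \<le> 2" using norm_triangle_ineq4[of "phase t" 1] by simp
  then have "(norm (phase t - 1))\<^sup>2 \<le> 2\<^sup>2" by (intro power_mono) auto
  also have "\<dots> \<le> 4 * pi\<^sup>2 * 1"
    using pi_gt3 one_le_power[of pi 2] by simp
  also have "\<dots> \<le> 4 * pi\<^sup>2 * (t\<^sup>2) powr m"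
    using False m by (intro mult_left_mono ge_one_powr_ge_zero) auto
  finally show ?thesis .
qed

lemma translation_energy_le_Hs:
  assumes f: "f \<in> Hs s" and s: "s > 0"
  shows "energy (\<lambda>x. f (x - y) - f x) \<le> ennreal (16 * pi\<^sup>2 * (norm y powr min s 1)\<^sup>2 * (Hs_norm s f)\<^sup>2)"
proof -
  define m where "m = min s 1"
  have m: "0 < m" "m \<le> 1" "m \<le> s" using s by (auto simp: m_def)
  have fL2: "f \<in> L2" and wL2: "sobolev_weighted s f \<in> L2" using f by (auto simp: Hs_def)
  have [measurable]: "fourier_L2 f \<in> borel_measurable borel" "sobolev_weighted s f \<in> borel_measurable borel"
    using fourier_L2_spec[OF fL2] wL2 by (auto simp: L2_iff_energy)
  have pt: "(norm ((phase (y \<bullet> \<xi>) - 1) * fourier_L2 f \<xi>))\<^sup>2 \<le> (4 * pi\<^sup>2 * (norm y powr m)\<^sup>2) * (norm (sobolev_weighted s f \<xi>))\<^sup>2" for \<xi>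
  proof -
    have "(y \<bullet> \<xi>)\<^sup>2 \<le> (norm y)\<^sup>2 * (norm \<xi>)\<^sup>2"
      using Cauchy_Schwarz_ineq[of y \<xi>] by (simp add: power2_norm_eq_inner)
    then have "((y \<bullet> \<xi>)\<^sup>2) powr m \<le> ((norm y)\<^sup>2 * (norm \<xi>)\<^sup>2) powr m"
      using m by (intro powr_mono2) auto
    also have "\<dots> = ((norm y)\<^sup>2) powr m * ((norm \<xi>)\<^sup>2) powr m" by (simp add: powr_mult)
    also have "((norm y)\<^sup>2) powr m = (norm y powr m)\<^sup>2" by (simp add: power2_eq_square powr_mult)
    also have "((norm \<xi>)\<^sup>2) powr m \<le> (1 + (norm \<xi>)\<^sup>2) powr m" using m by (intro powr_mono2) auto
    also have "\<dots> \<le> (1 + (norm \<xi>)\<^sup>2) powr s" using m by (intro powr_mono) auto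
    also have "\<dots> = ((1 + (norm \<xi>)\<^sup>2) powr (s/2))\<^sup>2" by (simp add: power2_eq_square flip: powr_add)
    finally have "((y \<bullet> \<xi>)\<^sup>2) powr m \<le> (norm y powr m)\<^sup>2 * ((1 + (norm \<xi>)\<^sup>2) powr (s/2))\<^sup>2"
      by (simp add: mult_left_mono)
    then have "4 * pi\<^sup>2 * ((y \<bullet> \<xi>)\<^sup>2) powr m \<le> 4 * pi\<^sup>2 * ((norm y powr m)\<^sup>2 * ((1 + (norm \<xi>)\<^sup>2) powr (s/2))\<^sup>2)"
      by (intro mult_left_mono) auto
    with phase_minus_one_le[OF m(1,2), of "y \<bullet> \<xi>"]
    have "(norm (phase (y \<bullet> \<xi>) - 1))\<^sup>2 \<le> 4 * pi\<^sup>2 * ((norm y powr m)\<^sup>2 * ((1 + (norm \<xi>)\<^sup>2) powr (s/2))\<^sup>2)"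
      by linarith
    then have "(norm (phase (y \<bullet> \<xi>) - 1))\<^sup>2 * (norm (fourier_L2 f \<xi>))\<^sup>2
       \<le> 4 * pi\<^sup>2 * ((norm y powr m)\<^sup>2 * ((1 + (norm \<xi>)\<^sup>2) powr (s/2))\<^sup>2) * (norm (fourier_L2 f \<xi>))\<^sup>2"
      by (intro mult_right_mono) auto
    then show ?thesis by (simp add: sobolev_weighted_def norm_mult power_mult_distrib ac_simps)
  qed
  have "energy (\<lambda>x. f (x - y) - f x) \<le> 4 * energy (\<lambda>\<xi>. (phase (y \<bullet> \<xi>) - 1) * fourier_L2 f \<xi>)"
    by (rule translation_energy_le_fourier[OF fL2])
  also have "\<dots> \<le> 4 * (\<integral>\<^sup>+\<xi>. ennreal (4 * pi\<^sup>2 * (norm y powr m)\<^sup>2) * ennreal ((norm (sobolev_weighted s f \<xi>))\<^sup>2) \<partial>lborel)"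
    unfolding energy_def using pt
    by (intro mult_left_mono nn_integral_mono) (auto simp flip: ennreal_mult' intro!: ennreal_leI)
  also have "\<dots> = 4 * (ennreal (4 * pi\<^sup>2 * (norm y powr m)\<^sup>2) * energy (sobolev_weighted s f))"
    unfolding energy_def by (subst nn_integral_cmult) auto
  also have "\<dots> = ennreal (16 * pi\<^sup>2 * (norm y powr m)\<^sup>2 * (Hs_norm s f)\<^sup>2)"
    unfolding L2_norm_power2[OF wL2] Hs_norm_def
    by (simp flip: ennreal_mult' ennreal_numeral add: mult.assoc)
  finally show ?thesis unfolding m_def .
qed

section \<open>Deformations as averages of translations\<close>

lemma nn_integral_le_cmult_measure:
  assumes "F \<in> borel_measurable M" and sets: "sets N = sets M"
    and le: "\<And>A. A \<in> sets M \<Longrightarrow> emeasure N A \<le> c * emeasure M A"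
  shows "(\<integral>\<^sup>+x. F x \<partial>N) \<le> c * (\<integral>\<^sup>+x. F x \<partial>M)"
proof -
  have "N \<le> scale_measure c M"
    using sets le by (subst le_measure) auto
  then have "(\<integral>\<^sup>+x. F x \<partial>N) \<le> (\<integral>\<^sup>+x. F x \<partial>scale_measure c M)"
    using sets by (intro nn_integral_mono_measure) auto
  also have "\<dots> = c * (\<integral>\<^sup>+x. F x \<partial>M)"
    using assms(1) by (rule nn_integral_scale_measure)
  finally show ?thesis .
qed

lemma Cb1_has_derivative:
  assumes "\<tau> \<in> Cb1"
  shows "(\<tau> has_derivative blinfun_apply (Deriv \<tau> x)) (at x)"
proof -
  have "(\<tau> has_derivative frechet_derivative \<tau> (at x)) (at x)"
    using assms by (simp add: Cb1_def frechet_derivative_works)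
  moreover from this have "bounded_linear (frechet_derivative \<tau> (at x))"
    by (rule has_derivative_bounded_linear)
  ultimately show ?thesis by (simp add: Deriv_def bounded_linear_Blinfun_apply)
qed

lemma norm_le_sup_norm: "bounded (range h) \<Longrightarrow> norm (h x) \<le> sup_norm h"
  unfolding sup_norm_def
  by (intro cSUP_upper) (auto simp: bounded_iff bdd_above_def)

text \<open>
  Both columns \<open>(a,c)\<close> and \<open>(b,d)\<close> of \<open>D\<close> have length at most \<open>1/2\<close>.  Hence
  \<open>b c \<le> (b\<^sup>2 + c\<^sup>2)/2 \<le> 1/4 - (a\<^sup>2 + d\<^sup>2)/2\<close>, and what remains of the determinant is \<open>1/4\<close> plus half the
  square of \<open>1 - (a + d)\<close>.
\<close>

lemma det_id_minus_contraction_ge: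
  fixes D :: "(real^2) \<Rightarrow>\<^sub>L (real^2)"
  assumes "norm D \<le> 1/2"
  shows "1/4 \<le> det (matrix (\<lambda>h. h - blinfun_apply D h))"
proof -
  define u where "u j = blinfun_apply D (axis j 1)" for j
  have u: "(u j $ 1)\<^sup>2 + (u j $ 2)\<^sup>2 \<le> 1/4" for j
  proof -
    have "norm (u j) \<le> norm D * norm (axis j 1 :: real^2)" unfolding u_def by (rule norm_blinfun)
    also have "\<dots> \<le> 1/2" using assms by (simp add: norm_axis_1)
    finally have "(norm (u j))\<^sup>2 \<le> (1/2)\<^sup>2" by (intro power_mono) auto
    moreover have "(norm (u j))\<^sup>2 = (u j $ 1)\<^sup>2 + (u j $ 2)\<^sup>2"
      unfolding power2_norm_eq_inner by (simp add: inner_vec_def sum_2 power2_eq_square)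
    ultimately show ?thesis by (simp add: power_divide)
  qed
  have "det (matrix (\<lambda>h. h - blinfun_apply D h)) = (1 - u 1 $ 1) * (1 - u 2 $ 2) - u 2 $ 1 * u 1 $ 2"
    by (simp add: det_2 matrix_def u_def axis_def)
  moreover have "1/4 \<le> (1 - a) * (1 - d) - b * c" if "a\<^sup>2 + c\<^sup>2 \<le> 1/4" "b\<^sup>2 + d\<^sup>2 \<le> 1/4" for a b c d :: real
  proof -
    have "2 * (b * c) \<le> b\<^sup>2 + c\<^sup>2" using sum_squares_bound[of b c] by simp
    moreover have "b\<^sup>2 + c\<^sup>2 \<le> 1/2 - (a\<^sup>2 + d\<^sup>2)" using that by simp
    ultimately have "2 * (b * c) \<le> 1/2 - (a\<^sup>2 + d\<^sup>2)" by (rule order_trans)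
    then have "b * c \<le> 1/4 - (a\<^sup>2 + d\<^sup>2) / 2" by (simp add: field_simps)
    moreover have "0 \<le> (1 - (a + d)) * (1 - (a + d))" by simp
    moreover have "(1 - a) * (1 - d) - (1/4 - (a\<^sup>2 + d\<^sup>2) / 2) = 1/4 + (1 - (a + d)) * (1 - (a + d)) / 2"
      by (simp add: power2_eq_square field_simps)
    ultimately show ?thesis by linarith
  qed
  ultimately show ?thesis using u[of 1] u[of 2] by simp
qed

text \<open>
  The map \<open>x \<mapsto> x - \<tau>(x)\<close> is injective, as \<open>\<tau>\<close> is a contraction, and its Jacobian determinant is at
  least \<open>1/4\<close>; so preimages have at most four times the measure of the set.
\<close>

lemma deformation_nn_integral_le:
  assumes \<tau>: "\<tau> \<in> Cb1" and D: "sup_norm (Deriv \<tau>) \<le> 1/2" and F: "F \<in> borel_measurable borel"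
  shows "(\<integral>\<^sup>+x. F (x - \<tau> x) \<partial>lborel) \<le> 4 * (\<integral>\<^sup>+x. F x \<partial>lborel)"
proof -
  define \<phi> where "\<phi> x = x - \<tau> x" for x
  have nD: "norm (Deriv \<tau> x) \<le> 1/2" for x
    using norm_le_sup_norm[of "Deriv \<tau>" x] \<tau> D by (auto simp: Cb1_def)
  have der: "(\<phi> has_derivative (\<lambda>h. h - blinfun_apply (Deriv \<tau> x) h)) (at x)" for x
    unfolding \<phi>_def[abs_def] by (intro derivative_intros Cb1_has_derivative \<tau>)
  have "continuous_on UNIV \<phi>"
    using der by (auto intro!: continuous_at_imp_continuous_on intro: has_derivative_continuous)
  then have \<phi>m [measurable]: "\<phi> \<in> borel_measurable borel" by (rule borel_measurable_continuous_onI)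
  have lip: "norm (\<tau> x - \<tau> y) \<le> 1/2 * norm (x - y)" for x y
    using Cb1_has_derivative[OF \<tau>] nD
    by (intro differentiable_bound[of UNIV \<tau> "\<lambda>x. blinfun_apply (Deriv \<tau> x)"])
       (auto simp: norm_blinfun.rep_eq)
  have inj: "inj \<phi>"
  proof (rule injI)
    fix x y assume "\<phi> x = \<phi> y"
    then have "x - y = \<tau> x - \<tau> y" by (simp add: \<phi>_def algebra_simps)
    with lip[of x y] show "x = y" by simp
  qed
  have image: "emeasure lborel (\<phi> -` A) \<le> 4 * emeasure lborel A" if A: "A \<in> sets borel" for A
  proof -
    have S: "emeasure lborel (\<phi> -` A \<inter> ball 0 (real n)) \<le> 4 * emeasure lborel A" for n
    proof -
      let ?S = "\<phi> -` A \<inter> ball 0 (real n)"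
      have Sb: "?S \<in> sets borel" using A measurable_sets[OF \<phi>m A] by simp
      then have Sl: "?S \<in> sets lebesgue" by simp
      have Sm: "?S \<in> lmeasurable" using Sl by (intro bounded_set_imp_lmeasurable) auto
      have diff: "\<phi> differentiable_on ?S"
        using der by (auto simp: differentiable_on_def differentiable_def intro: has_derivative_at_withinI)
      have "bounded (\<phi> ` ?S)"
      proof -
        obtain T where T: "\<And>x. norm (\<tau> x) \<le> T" using \<tau> by (auto simp: Cb1_def bounded_iff)
        have "norm (\<phi> x) \<le> real n + T" if "x \<in> ?S" for x
          using T[of x] that norm_triangle_ineq4[of x "\<tau> x"] by (simp add: \<phi>_def)
        then show ?thesis by (intro boundedI[of _ "real n + T"]) blast
      qed
      then have im: "\<phi> ` ?S \<in> lmeasurable"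
        using differentiable_image_in_sets_lebesgue[OF Sl _ diff] by (intro bounded_set_imp_lmeasurable) auto
      then have Adet: "((\<lambda>x. \<bar>det (matrix (\<lambda>h. h - blinfun_apply (Deriv \<tau> x) h))\<bar>) has_integral measure lebesgue (\<phi> ` ?S)) ?S"
        using has_measure_differentiable_image[OF Sl has_derivative_at_withinI[OF der] inj_on_subset[OF inj subset_UNIV]]
        by blast
      have Aconst: "((\<lambda>x. 1/4 :: real) has_integral (1/4 * measure lebesgue ?S)) ?S"
      proof -
        have "((\<lambda>x. 1 :: real) has_integral measure lebesgue ?S) ?S"
          using Sm by (simp add: has_integral_iff lmeasurable_iff_integrable_on lmeasure_integral)
        from has_integral_mult_right[OF this, of "1/4"] show ?thesis by simp
      qed
      have "1/4 * measure lebesgue ?S \<le> measure lebesgue (\<phi> ` ?S)"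
        by (rule has_integral_le[OF Aconst Adet])
           (rule order_trans[OF det_id_minus_contraction_ge[OF nD] abs_ge_self])
      then have "emeasure lebesgue ?S \<le> 4 * emeasure lebesgue (\<phi> ` ?S)"
        using Sm im by (simp add: emeasure_eq_measure2 flip: ennreal_mult' ennreal_numeral)
      also have "\<dots> \<le> 4 * emeasure lebesgue A"
        using A by (intro mult_left_mono emeasure_mono) auto
      finally show ?thesis using Sb A by simp
    qed
    \<comment> \<open>The image formula needs sets of finite measure, hence the exhaustion by balls.\<close>
    have "emeasure lborel (\<phi> -` A) = emeasure lborel (\<Union>n. \<phi> -` A \<inter> ball 0 (real n))"
      by (intro arg_cong[of _ _ "emeasure lborel"]) (auto intro: reals_Archimedean2)
    also have "\<dots> = (SUP n. emeasure lborel (\<phi> -` A \<inter> ball 0 (real n)))"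
      using measurable_sets[OF \<phi>m A]
      by (intro SUP_emeasure_incseq[symmetric]) (auto simp: incseq_def)
    also have "\<dots> \<le> 4 * emeasure lborel A" by (intro SUP_least S)
    finally show ?thesis .
  qed
  have "(\<integral>\<^sup>+x. F (x - \<tau> x) \<partial>lborel) = (\<integral>\<^sup>+x. F x \<partial>distr lborel borel \<phi>)"
    using F by (subst nn_integral_distr) (auto simp: \<phi>_def)
  also have "\<dots> \<le> 4 * (\<integral>\<^sup>+x. F x \<partial>lborel)"
  proof (rule nn_integral_le_cmult_measure)
    show "emeasure (distr lborel borel \<phi>) A \<le> 4 * emeasure lborel A" if "A \<in> sets lborel" for A
      using that image[of A] by (subst emeasure_distr) auto
  qed (use F in auto)
  finally show ?thesis .
qed

text \<open>
  Average the decomposition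
  \<open>f(x - \<tau>(x)) - f(x) = [f(x - \<tau>(x)) - f(x - \<tau>(x) - z)] + [f(x - \<tau>(x) - z) - f(x)]\<close> over \<open>z\<close> in the
  disc of radius \<open>\<delta>\<close>.  Each bracket contributes \<open>2 \<cdot> 4\<close>: for the first one \<open>4\<close> is the bound for the
  change of variables, for the second one it is the ratio of the areas of the discs of radius
  \<open>2\<delta>\<close> and \<open>\<delta>\<close>.
\<close>

lemma deformation_energy_le_translations:
  fixes f :: "real^2 \<Rightarrow> complex"
  assumes f [measurable]: "f \<in> borel_measurable borel" and \<tau>m [measurable]: "\<tau> \<in> borel_measurable borel"
    and push: "\<And>F. F \<in> borel_measurable borel \<Longrightarrow> (\<integral>\<^sup>+x. F (x - \<tau> x) \<partial>lborel) \<le> 4 * (\<integral>\<^sup>+x. F x \<partial>lborel)"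
    and \<delta>: "0 < \<delta>" "\<And>x. norm (\<tau> x) \<le> \<delta>"
    and B: "\<And>z. norm z \<le> 2 * \<delta> \<Longrightarrow> energy (\<lambda>x. f (x - z) - f x) \<le> B"
  shows "energy (\<lambda>x. f (x - \<tau> x) - f x) \<le> 16 * B"
proof -
  define b b2 where "b = ball (0::real^2) \<delta>" and "b2 = ball (0::real^2) (2 * \<delta>)"
  have [measurable]: "b \<in> sets borel" "b2 \<in> sets borel" by (auto simp: b_def b2_def)
  define V where "V = emeasure lborel b"
  have V2: "emeasure lborel b2 = 4 * V"
    unfolding V_def b_def b2_def using \<delta>(1) by (simp add: emeasure_ball power_mult_distrib flip: ennreal_mult' ennreal_numeral)
  have V: "V \<noteq> 0" "V \<noteq> \<infinity>"
    unfolding V_def b_def b2_def using \<delta>(1) by (auto simp: emeasure_ball unit_ball_vol_2)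
  let ?e = "\<lambda>w. ennreal ((norm w)\<^sup>2)"
  have split: "?e (a - c) \<le> 2 * ?e (b - a) + 2 * ?e (b - c)" for a b c :: complex
  proof -
    have "norm (a - c) \<le> norm (b - a) + norm (b - c)" by norm
    then have "(norm (a - c))\<^sup>2 \<le> (norm (b - a) + norm (b - c))\<^sup>2" by (intro power_mono) auto
    also have "\<dots> \<le> 2 * (norm (b - a))\<^sup>2 + 2 * (norm (b - c))\<^sup>2"
      using zero_le_power2[of "norm (b - a) - norm (b - c)"] unfolding power2_sum power2_diff by linarith
    finally show ?thesis by (simp flip: ennreal_plus ennreal_mult' ennreal_numeral add: ennreal_leI)
  qed
  have "V * energy (\<lambda>x. f (x - \<tau> x) - f x) = (\<integral>\<^sup>+x. \<integral>\<^sup>+z. indicator b z * ?e (f (x - \<tau> x) - f x) \<partial>lborel \<partial>lborel)"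
    unfolding energy_def V_def
    by (subst nn_integral_cmult[symmetric], measurable, subst nn_integral_multc) simp_all
  also have "\<dots> \<le> (\<integral>\<^sup>+x. \<integral>\<^sup>+z. 2 * (indicator b z * ?e (f (x - \<tau> x - z) - f (x - \<tau> x)))
      + 2 * (indicator b z * ?e (f (x - \<tau> x - z) - f x)) \<partial>lborel \<partial>lborel)"
  proof (intro nn_integral_mono)
    fix x z
    show "indicator b z * ?e (f (x - \<tau> x) - f x) \<le> 2 * (indicator b z * ?e (f (x - \<tau> x - z) - f (x - \<tau> x)))
      + 2 * (indicator b z * ?e (f (x - \<tau> x - z) - f x))"
      using split[of "f (x - \<tau> x)" "f x" "f (x - \<tau> x - z)"] by (cases "z \<in> b") simp_all
  qed
  also have "\<dots> = 2 * (\<integral>\<^sup>+x. \<integral>\<^sup>+z. indicator b z * ?e (f (x - \<tau> x - z) - f (x - \<tau> x)) \<partial>lborel \<partial>lborel)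
      + 2 * (\<integral>\<^sup>+x. \<integral>\<^sup>+z. indicator b z * ?e (f (x - \<tau> x - z) - f x) \<partial>lborel \<partial>lborel)"
    by (subst nn_integral_add, measurable, subst nn_integral_add, measurable) (simp add: nn_integral_cmult)
  also have "(\<integral>\<^sup>+x. \<integral>\<^sup>+z. indicator b z * ?e (f (x - \<tau> x - z) - f (x - \<tau> x)) \<partial>lborel \<partial>lborel) \<le> 4 * (V * B)"
  proof -
    have "(\<integral>\<^sup>+x. \<integral>\<^sup>+z. indicator b z * ?e (f (x - \<tau> x - z) - f (x - \<tau> x)) \<partial>lborel \<partial>lborel)
      \<le> 4 * (\<integral>\<^sup>+x. \<integral>\<^sup>+z. indicator b z * ?e (f (x - z) - f x) \<partial>lborel \<partial>lborel)"
      by (rule push[of "\<lambda>v. \<integral>\<^sup>+z. indicator b z * ?e (f (v - z) - f v) \<partial>lborel"]) measurable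
    also have "(\<integral>\<^sup>+x. \<integral>\<^sup>+z. indicator b z * ?e (f (x - z) - f x) \<partial>lborel \<partial>lborel) =
       (\<integral>\<^sup>+z. \<integral>\<^sup>+x. indicator b z * ?e (f (x - z) - f x) \<partial>lborel \<partial>lborel)"
      by (rule lborel_pair.Fubini'[symmetric]) measurable
    also have "\<dots> = (\<integral>\<^sup>+z. indicator b z * energy (\<lambda>x. f (x - z) - f x) \<partial>lborel)"
      unfolding energy_def by (simp add: nn_integral_cmult)
    also have "\<dots> \<le> (\<integral>\<^sup>+z. indicator b z * B \<partial>lborel)"
      using \<delta>(1) B by (intro nn_integral_mono) (auto simp: b_def split: split_indicator)
    also have "\<dots> = V * B" unfolding V_def by (simp add: nn_integral_multc)
    finally show ?thesis by (simp add: mult_left_mono)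
  qed
  also have "(\<integral>\<^sup>+x. \<integral>\<^sup>+z. indicator b z * ?e (f (x - \<tau> x - z) - f x) \<partial>lborel \<partial>lborel) \<le> 4 * (V * B)"
  proof -
    have "(\<integral>\<^sup>+z. indicator b z * ?e (f (x - \<tau> x - z) - f x) \<partial>lborel)
        \<le> (\<integral>\<^sup>+z. indicator b2 z * ?e (f (x - z) - f x) \<partial>lborel)" for x
    proof -
      have "(\<integral>\<^sup>+z. indicator b z * ?e (f (x - \<tau> x - z) - f x) \<partial>lborel)
        \<le> (\<integral>\<^sup>+z. indicator b2 (z - (- \<tau> x)) * ?e (f (x - (z - (- \<tau> x))) - f x) \<partial>lborel)"
      proof (intro nn_integral_mono)
        fix z
        have "z + \<tau> x \<in> b2" if "z \<in> b" using that \<delta>(2)[of x] norm_triangle_ineq[of z "\<tau> x"] by (simp add: b_def b2_def)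
        then show "indicator b z * ?e (f (x - \<tau> x - z) - f x)
            \<le> indicator b2 (z - (- \<tau> x)) * ?e (f (x - (z - (- \<tau> x))) - f x)"
          by (auto split: split_indicator simp: algebra_simps)
      qed
      also have "\<dots> = (\<integral>\<^sup>+z. indicator b2 z * ?e (f (x - z) - f x) \<partial>lborel)"
        by (rule nn_integral_lborel_translate) measurable
      finally show ?thesis .
    qed
    then have "(\<integral>\<^sup>+x. \<integral>\<^sup>+z. indicator b z * ?e (f (x - \<tau> x - z) - f x) \<partial>lborel \<partial>lborel)
      \<le> (\<integral>\<^sup>+x. \<integral>\<^sup>+z. indicator b2 z * ?e (f (x - z) - f x) \<partial>lborel \<partial>lborel)"
      by (rule nn_integral_mono)
    also have "\<dots> = (\<integral>\<^sup>+z. \<integral>\<^sup>+x. indicator b2 z * ?e (f (x - z) - f x) \<partial>lborel \<partial>lborel)"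
      by (rule lborel_pair.Fubini'[symmetric]) measurable
    also have "\<dots> = (\<integral>\<^sup>+z. indicator b2 z * energy (\<lambda>x. f (x - z) - f x) \<partial>lborel)"
      unfolding energy_def by (simp add: nn_integral_cmult)
    also have "\<dots> \<le> (\<integral>\<^sup>+z. indicator b2 z * B \<partial>lborel)"
      using B by (intro nn_integral_mono) (auto simp: b2_def split: split_indicator)
    also have "\<dots> = 4 * (V * B)" using V2 by (simp add: nn_integral_multc mult.assoc)
    finally show ?thesis .
  qed
  also have "2 * (4 * (V * B)) + 2 * (4 * (V * B)) = V * (16 * B)"
  proof -
    have "2 * (4 * W) + 2 * (4 * W) = 16 * W" for W :: ennreal
      by (simp only: mult.assoc[symmetric] distrib_right[symmetric]) simp
    then show ?thesis by (simp only: mult.left_commute[of V])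
  qed
  finally have "V * energy (\<lambda>x. f (x - \<tau> x) - f x) \<le> V * (16 * B)" by this (auto intro!: add_mono mult_left_mono)
  then show ?thesis using V by (simp add: ennreal_mult_le_mult_iff)
qed

lemma deform_L2_norm_le:
  assumes s: "s > 0" and f: "f \<in> Hs s" and \<tau>: "\<tau> \<in> Cb1"
    and D: "sup_norm (Deriv \<tau>) \<le> 1/2"
  shows "(\<lambda>x. deform \<tau> f x - f x) \<in> L2"
    and "L2_norm (\<lambda>x. deform \<tau> f x - f x) \<le> 32 * pi * sup_norm \<tau> powr min s 1 * Hs_norm s f"
proof -
  define m \<delta> N where "m = min s 1" and "\<delta> = sup_norm \<tau>" and "N = Hs_norm s f"
  have m: "0 < m" "m \<le> 1" using s by (auto simp: m_def)
  have N: "N \<ge> 0" by (simp add: N_def Hs_norm_def)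
  have \<tau>\<delta>: "norm (\<tau> x) \<le> \<delta>" for x
    unfolding \<delta>_def using \<tau> by (intro norm_le_sup_norm) (auto simp: Cb1_def)
  have \<delta>0: "\<delta> \<ge> 0" using norm_ge_zero order_trans \<tau>\<delta> by blast
  have fm [measurable]: "f \<in> borel_measurable borel" using f by (auto simp: Hs_def L2_iff_energy)
  have "continuous_on UNIV \<tau>"
    using Cb1_has_derivative[OF \<tau>] by (auto intro!: continuous_at_imp_continuous_on intro: has_derivative_continuous)
  then have \<tau>m [measurable]: "\<tau> \<in> borel_measurable borel" by (rule borel_measurable_continuous_onI)
  have gm: "(\<lambda>x. deform \<tau> f x - f x) \<in> borel_measurable borel" unfolding deform_def by measurable
  have "energy (\<lambda>x. f (x - \<tau> x) - f x) \<le> ennreal ((32 * pi * \<delta> powr m * N)\<^sup>2)"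
  proof (cases "\<delta> = 0")
    case True
    then have "\<tau> x = 0" for x using \<tau>\<delta>[of x] by simp
    then show ?thesis by (simp add: energy_def)
  next
    case False
    then have \<delta>: "\<delta> > 0" using \<delta>0 by simp
    have "energy (\<lambda>x. f (x - \<tau> x) - f x) \<le> 16 * ennreal (16 * pi\<^sup>2 * ((2 * \<delta>) powr m)\<^sup>2 * N\<^sup>2)"
    proof (rule deformation_energy_le_translations[OF fm \<tau>m _ \<delta> \<tau>\<delta>])
      show "(\<integral>\<^sup>+x. F (x - \<tau> x) \<partial>lborel) \<le> 4 * (\<integral>\<^sup>+x. F x \<partial>lborel)" if "F \<in> borel_measurable borel" for F
        by (rule deformation_nn_integral_le[OF \<tau> D that])
      fix z :: "real^2" assume z: "norm z \<le> 2 * \<delta>"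
      have "norm z powr m \<le> (2 * \<delta>) powr m" using z m by (intro powr_mono2) auto
      then have "(norm z powr m)\<^sup>2 \<le> ((2 * \<delta>) powr m)\<^sup>2" by (intro power_mono) auto
      then have "16 * pi\<^sup>2 * (norm z powr m)\<^sup>2 * N\<^sup>2 \<le> 16 * pi\<^sup>2 * ((2 * \<delta>) powr m)\<^sup>2 * N\<^sup>2"
        by (intro mult_right_mono mult_left_mono) auto
      then show "energy (\<lambda>x. f (x - z) - f x) \<le> ennreal (16 * pi\<^sup>2 * ((2 * \<delta>) powr m)\<^sup>2 * N\<^sup>2)"
        using translation_energy_le_Hs[OF f s, of z] unfolding m_def[symmetric] N_def[symmetric]
        by (meson ennreal_leI order_trans)
    qed
    also have "\<dots> = ennreal ((16 * pi * (2 * \<delta>) powr m * N)\<^sup>2)"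
      by (simp add: power_mult_distrib flip: ennreal_mult' ennreal_numeral)
    also have "\<dots> \<le> ennreal ((32 * pi * \<delta> powr m * N)\<^sup>2)"
    proof (intro ennreal_leI power_mono)
      have "(2 * \<delta>) powr m = 2 powr m * \<delta> powr m" by (simp add: powr_mult)
      also have "\<dots> \<le> 2 powr 1 * \<delta> powr m" using m by (intro mult_right_mono powr_mono) auto
      finally have "16 * pi * ((2 * \<delta>) powr m) * N \<le> 16 * pi * (2 powr 1 * \<delta> powr m) * N"
        using N by (intro mult_right_mono mult_left_mono) auto
      then show "16 * pi * (2 * \<delta>) powr m * N \<le> 32 * pi * \<delta> powr m * N" by simp
    qed (use N in auto)
    finally show ?thesis .
  qed
  then have "energy (\<lambda>x. deform \<tau> f x - f x) \<le> ennreal ((32 * pi * \<delta> powr m * N)\<^sup>2)"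
    by (simp add: deform_def)
  from L2_norm_le_energy[OF gm this] N
  show "(\<lambda>x. deform \<tau> f x - f x) \<in> L2"
    "L2_norm (\<lambda>x. deform \<tau> f x - f x) \<le> 32 * pi * sup_norm \<tau> powr min s 1 * Hs_norm s f"
    by (auto simp: m_def \<delta>_def N_def)
qed

lemma translation_opnorm_le:
  assumes s: "s > 0"
  shows "translation_opnorm s y \<le> ennreal (4 * pi * norm y powr min s 1)"
  unfolding translation_opnorm_def
proof (intro SUP_least ennreal_leI)
  fix f assume "f \<in> {f \<in> Hs s. Hs_norm s f \<le> 1}"
  then have f: "f \<in> Hs s" and N: "Hs_norm s f \<le> 1" by auto
  have fm [measurable]: "f \<in> borel_measurable borel" using f by (auto simp: Hs_def L2_iff_energy)
  have "0 \<le> Hs_norm s f" by (simp add: Hs_norm_def)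
  then have "(Hs_norm s f)\<^sup>2 \<le> 1" using N by (simp add: power_le_one)
  then have "16 * pi\<^sup>2 * (norm y powr min s 1)\<^sup>2 * (Hs_norm s f)\<^sup>2 \<le> 16 * pi\<^sup>2 * (norm y powr min s 1)\<^sup>2 * 1"
    by (intro mult_left_mono) auto
  also have "\<dots> = (4 * pi * norm y powr min s 1)\<^sup>2" by (simp add: power_mult_distrib)
  finally have "energy (\<lambda>x. f (x - y) - f x) \<le> ennreal ((4 * pi * norm y powr min s 1)\<^sup>2)"
    using translation_energy_le_Hs[OF f s, of y] by (meson ennreal_leI order_trans)
  then show "L2_norm (\<lambda>x. deform (\<lambda>_. y) f x - f x) \<le> 4 * pi * norm y powr min s 1"
    unfolding deform_def by (intro L2_norm_le_energy) auto
qed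

section \<open>Wave packets\<close>

text \<open>
  Half of the Gaussian decay absorbs the polynomial weight.
\<close>

lemma bessel_weight_gauss_le:
  assumes "0 \<le> s"
  shows "(1 + (norm x)\<^sup>2) powr s * gauss 2 x \<le> (max 1 s) powr s * gauss 1 x"
proof -
  \<comment> \<open>With \<open>k \<ge> max 1 s\<close> the bound \<open>1 + t \<le> k exp (t/k)\<close>, raised to the power \<open>s\<close>, grows at most like \<open>exp t\<close>.\<close>
  define t k where "t = (norm x)\<^sup>2" and "k = max 1 s"
  have t: "t \<ge> 0" and k: "k \<ge> 1" "s \<le> k" by (auto simp: t_def k_def)
  have "1 + t \<le> k * (1 + t / k)" using k by (simp add: field_simps)
  also have "\<dots> \<le> k * exp (t / k)" using k by (intro mult_left_mono exp_ge_add_one_self) auto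
  finally have "(1 + t) powr s \<le> (k * exp (t / k)) powr s" using assms t by (intro powr_mono2) auto
  also have "\<dots> = k powr s * exp (t * (s / k))" using k by (simp add: powr_mult exp_powr_real)
  also have "\<dots> \<le> k powr s * exp (t * pi)"
  proof -
    have "s / k \<le> 1" using k by (simp add: divide_le_eq)
    also have "1 \<le> pi" using pi_gt3 by simp
    finally have "t * (s / k) \<le> t * pi" using t by (intro mult_left_mono)
    then show ?thesis by (intro mult_left_mono) auto
  qed
  finally have "(1 + t) powr s * gauss 2 x \<le> k powr s * exp (t * pi) * gauss 2 x"
    by (intro mult_right_mono) auto
  also have "\<dots> = k powr s * (exp (t * pi) * gauss 2 x)" by (simp add: mult.assoc)
  also have "exp (t * pi) * gauss 2 x = gauss 1 x"
    unfolding gauss_def t_def by (simp flip: exp_add add: algebra_simps)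
  finally show ?thesis by (simp add: t_def k_def)
qed

text \<open>
  Peetre's inequality; it moves a weight at \<open>\<xi>\<close> to weights at \<open>\<xi> - \<eta>\<close> and \<open>\<eta>\<close>.
\<close>

lemma bessel_weight_add_le:
  fixes a b :: "'a::real_inner"
  shows "1 + (norm (a + b))\<^sup>2 \<le> 2 * (1 + (norm a)\<^sup>2) * (1 + (norm b)\<^sup>2)"
proof -
  have "(norm (a + b))\<^sup>2 \<le> (norm a + norm b)\<^sup>2" by (intro power_mono norm_triangle_ineq) auto
  also have "\<dots> \<le> 2 * (norm a)\<^sup>2 + 2 * (norm b)\<^sup>2"
    using zero_le_power2[of "norm a - norm b"] unfolding power2_sum power2_diff by linarith
  finally have "1 + (norm (a + b))\<^sup>2 \<le> 1 + (2 * (norm a)\<^sup>2 + 2 * (norm b)\<^sup>2)" by simp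
  also have "\<dots> \<le> 2 * (1 + (norm a)\<^sup>2) * (1 + (norm b)\<^sup>2)" by (simp add: algebra_simps)
  finally show ?thesis .
qed

lemma gauss_1_power2: "(gauss 1 x)\<^sup>2 = gauss 2 x"
  by (simp add: gauss_def flip: exp_double)

text \<open>
  After removal of the common phase the difference is a unimodular multiple of \<open>G(x - y)\<close> minus the
  real number \<open>G(x)\<close>, so its imaginary part involves \<open>G(x - y)\<close> alone.
\<close>

lemma wave_packet_translation_energy:
  "ennreal (\<alpha>\<^sup>2 * (sin (2 * pi * (y \<bullet> \<eta>)))\<^sup>2 / 2) \<le>
    energy (\<lambda>x. phase (- ((x - y) \<bullet> \<eta>)) * complex_of_real (\<alpha> * gauss 1 (x - y)) - phase (- (x \<bullet> \<eta>)) * complex_of_real (\<alpha> * gauss 1 x))"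
proof -
  let ?S = "sin (2 * pi * (y \<bullet> \<eta>))"
  have Im: "Im (phase t) = - sin (2 * pi * t)" for t
    by (simp add: phase_def Im_exp)
  have pt: "\<alpha>\<^sup>2 * ?S\<^sup>2 * gauss 2 (x - y) \<le>
     (norm (phase (- ((x - y) \<bullet> \<eta>)) * complex_of_real (\<alpha> * gauss 1 (x - y)) - phase (- (x \<bullet> \<eta>)) * complex_of_real (\<alpha> * gauss 1 x)))\<^sup>2" for x
  proof -
    have "- ((x - y) \<bullet> \<eta>) = - (x \<bullet> \<eta>) + y \<bullet> \<eta>" by (simp add: inner_diff_left)
    then have "phase (- ((x - y) \<bullet> \<eta>)) * complex_of_real (\<alpha> * gauss 1 (x - y)) - phase (- (x \<bullet> \<eta>)) * complex_of_real (\<alpha> * gauss 1 x)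
      = phase (- (x \<bullet> \<eta>)) * (phase (y \<bullet> \<eta>) * complex_of_real (\<alpha> * gauss 1 (x - y)) - complex_of_real (\<alpha> * gauss 1 x))"
      by (simp only: phase_add) (simp add: algebra_simps)
    then have "norm (phase (- ((x - y) \<bullet> \<eta>)) * complex_of_real (\<alpha> * gauss 1 (x - y)) - phase (- (x \<bullet> \<eta>)) * complex_of_real (\<alpha> * gauss 1 x))
      = norm (phase (y \<bullet> \<eta>) * complex_of_real (\<alpha> * gauss 1 (x - y)) - complex_of_real (\<alpha> * gauss 1 x))"
      by (simp only: norm_mult norm_phase mult_1)
    moreover have "\<bar>\<alpha> * ?S * gauss 1 (x - y)\<bar> \<le> norm (phase (y \<bullet> \<eta>) * complex_of_real (\<alpha> * gauss 1 (x - y)) - complex_of_real (\<alpha> * gauss 1 x))"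
      using abs_Im_le_cmod[of "phase (y \<bullet> \<eta>) * complex_of_real (\<alpha> * gauss 1 (x - y)) - complex_of_real (\<alpha> * gauss 1 x)"]
      by (simp add: Im abs_mult ac_simps)
    ultimately have "\<bar>\<alpha> * ?S * gauss 1 (x - y)\<bar>\<^sup>2 \<le> (norm (phase (- ((x - y) \<bullet> \<eta>)) * complex_of_real (\<alpha> * gauss 1 (x - y)) - phase (- (x \<bullet> \<eta>)) * complex_of_real (\<alpha> * gauss 1 x)))\<^sup>2"
      by (intro power_mono) auto
    then show ?thesis by (simp add: power_mult_distrib gauss_1_power2)
  qed
  have "ennreal (\<alpha>\<^sup>2 * ?S\<^sup>2 / 2) = ennreal (\<alpha>\<^sup>2 * ?S\<^sup>2) * ennreal (1/2)"
    by (subst ennreal_mult'[symmetric]) auto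
  also have "ennreal (1/2) = (\<integral>\<^sup>+x. ennreal (gauss 2 (x - y)) \<partial>lborel)"
    by (subst nn_integral_lborel_translate) (auto simp: nn_integral_gauss)
  also have "ennreal (\<alpha>\<^sup>2 * ?S\<^sup>2) * \<dots> = (\<integral>\<^sup>+x. ennreal (\<alpha>\<^sup>2 * ?S\<^sup>2 * gauss 2 (x - y)) \<partial>lborel)"
    by (subst nn_integral_cmult[symmetric]) (auto simp: ennreal_mult')
  also have "\<dots> \<le> energy (\<lambda>x. phase (- ((x - y) \<bullet> \<eta>)) * complex_of_real (\<alpha> * gauss 1 (x - y)) - phase (- (x \<bullet> \<eta>)) * complex_of_real (\<alpha> * gauss 1 x))"
    unfolding energy_def using pt by (intro nn_integral_mono ennreal_leI)
  finally show ?thesis .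
qed

text \<open>
  The transform is a Gaussian centred at \<open>\<eta>\<close>, so up to a constant the weight may be evaluated at \<open>\<eta>\<close>.
\<close>

lemma wave_packet_Hs:
  fixes \<eta> :: "real^2" and \<alpha> :: real
  assumes s: "0 \<le> s"
  defines "f \<equiv> \<lambda>x. phase (- (x \<bullet> \<eta>)) * complex_of_real (\<alpha> * gauss 1 x)"
  shows "f \<in> Hs s" and "(Hs_norm s f)\<^sup>2 \<le> \<alpha>\<^sup>2 * (2 * max 1 s * (1 + (norm \<eta>)\<^sup>2)) powr s"
proof -
  define A where "A = \<alpha>\<^sup>2 * (2 * max 1 s * (1 + (norm \<eta>)\<^sup>2)) powr s"
  have A0: "A \<ge> 0" by (simp add: A_def)
  have gint: "integrable lborel (\<lambda>x. complex_of_real (\<alpha> * gauss 1 x))"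
    by (intro integrable_of_real integrable_mult_right gauss_integrable) simp
  then have fint: "integrable lborel f" unfolding f_def by (intro integrable_phase_mult) auto
  then have fm [measurable]: "f \<in> borel_measurable borel" by simp
  have "energy f = (\<integral>\<^sup>+x. ennreal (\<alpha>\<^sup>2) * ennreal (gauss 2 x) \<partial>lborel)"
    unfolding energy_def f_def
    by (intro nn_integral_cong) (simp add: norm_mult power_mult_distrib gauss_1_power2 ennreal_mult')
  also have "\<dots> = ennreal (\<alpha>\<^sup>2) * ennreal (1/2)" by (subst nn_integral_cmult) (auto simp: nn_integral_gauss)
  also have "\<dots> < \<infinity>" by (subst ennreal_mult'[symmetric]) auto
  finally have fL2: "f \<in> L2" by (simp add: L2_iff_energy)
  have F: "fourier_integral f \<xi> = complex_of_real (\<alpha> * gauss 1 (\<xi> - \<eta>))" for \<xi>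
  proof -
    have "fourier_integral f \<xi> = fourier_integral (\<lambda>x. complex_of_real (\<alpha> * gauss 1 x)) (\<xi> - \<eta>)"
      unfolding f_def by (rule fourier_integral_modulate)
    also have "\<dots> = complex_of_real \<alpha> * fourier_integral (\<lambda>x. complex_of_real (gauss 1 x)) (\<xi> - \<eta>)"
      unfolding fourier_integral_phase by (simp add: mult.left_commute)
    finally show ?thesis by (simp add: fourier_gauss)
  qed
  have wm: "sobolev_weighted s f \<in> borel_measurable borel"
    using fourier_L2_spec(1)[OF fL2] unfolding sobolev_weighted_def[abs_def]
    by (auto simp: L2_iff_energy)
  have pt: "(1 + (norm \<xi>)\<^sup>2) powr s * (\<alpha>\<^sup>2 * gauss 2 (\<xi> - \<eta>)) \<le> A * gauss 1 (\<xi> - \<eta>)" for \<xi>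
  proof -
    have "1 + (norm \<xi>)\<^sup>2 \<le> 2 * (1 + (norm (\<xi> - \<eta>))\<^sup>2) * (1 + (norm \<eta>)\<^sup>2)"
      using bessel_weight_add_le[of "\<xi> - \<eta>" \<eta>] by simp
    then have "(1 + (norm \<xi>)\<^sup>2) powr s \<le> (2 * (1 + (norm (\<xi> - \<eta>))\<^sup>2) * (1 + (norm \<eta>)\<^sup>2)) powr s"
      using s by (intro powr_mono2) auto
    also have "2 * (1 + (norm (\<xi> - \<eta>))\<^sup>2) * (1 + (norm \<eta>)\<^sup>2) = (2 * (1 + (norm \<eta>)\<^sup>2)) * (1 + (norm (\<xi> - \<eta>))\<^sup>2)"
      by (simp only: ac_simps)
    also have "\<dots> powr s = (2 * (1 + (norm \<eta>)\<^sup>2)) powr s * (1 + (norm (\<xi> - \<eta>))\<^sup>2) powr s"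
      by (subst powr_mult) auto
    finally have "(1 + (norm \<xi>)\<^sup>2) powr s * (\<alpha>\<^sup>2 * gauss 2 (\<xi> - \<eta>)) \<le>
        (2 * (1 + (norm \<eta>)\<^sup>2)) powr s * (1 + (norm (\<xi> - \<eta>))\<^sup>2) powr s * (\<alpha>\<^sup>2 * gauss 2 (\<xi> - \<eta>))"
      by (intro mult_right_mono) auto
    also have "\<dots> = \<alpha>\<^sup>2 * (2 * (1 + (norm \<eta>)\<^sup>2)) powr s * ((1 + (norm (\<xi> - \<eta>))\<^sup>2) powr s * gauss 2 (\<xi> - \<eta>))"
      by (simp add: ac_simps)
    also have "\<dots> \<le> \<alpha>\<^sup>2 * (2 * (1 + (norm \<eta>)\<^sup>2)) powr s * (max 1 s powr s * gauss 1 (\<xi> - \<eta>))"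
      by (intro mult_left_mono bessel_weight_gauss_le s) auto
    also have "\<dots> = A * gauss 1 (\<xi> - \<eta>)"
    proof -
      have "2 * max 1 s * (1 + (norm \<eta>)\<^sup>2) = (2 * (1 + (norm \<eta>)\<^sup>2)) * max 1 s" by (simp only: ac_simps)
      also have "\<dots> powr s = (2 * (1 + (norm \<eta>)\<^sup>2)) powr s * max 1 s powr s" by (subst powr_mult) auto
      finally show ?thesis unfolding A_def by (simp only: mult.assoc)
    qed
    finally show ?thesis .
  qed
  have "energy (sobolev_weighted s f) \<le> (\<integral>\<^sup>+\<xi>. ennreal A * ennreal (gauss 1 (\<xi> - \<eta>)) \<partial>lborel)"
    unfolding energy_def
  proof (rule nn_integral_mono_AE)
    show "AE \<xi> in lborel. ennreal ((norm (sobolev_weighted s f \<xi>))\<^sup>2) \<le> ennreal A * ennreal (gauss 1 (\<xi> - \<eta>))"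
      using fourier_L2_eq_fourier_integral[OF fL2 fint]
    proof eventually_elim
      case (elim \<xi>)
      have "((1 + (norm \<xi>)\<^sup>2) powr (s/2))\<^sup>2 = (1 + (norm \<xi>)\<^sup>2) powr s"
        by (simp add: power2_eq_square flip: powr_add)
      then have "(norm (sobolev_weighted s f \<xi>))\<^sup>2 = (1 + (norm \<xi>)\<^sup>2) powr s * (\<alpha>\<^sup>2 * gauss 2 (\<xi> - \<eta>))"
        unfolding sobolev_weighted_def elim F by (simp add: norm_mult power_mult_distrib gauss_1_power2)
      with pt[of \<xi>] A0 show ?case by (simp flip: ennreal_mult' add: ennreal_leI)
    qed
  qed
  also have "\<dots> = ennreal A * (\<integral>\<^sup>+\<xi>. ennreal (gauss 1 (\<xi> - \<eta>)) \<partial>lborel)"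
    by (rule nn_integral_cmult) measurable
  also have "(\<integral>\<^sup>+\<xi>. ennreal (gauss 1 (\<xi> - \<eta>)) \<partial>lborel) = 1"
    by (subst nn_integral_lborel_translate) (auto simp: nn_integral_gauss)
  finally have E: "energy (sobolev_weighted s f) \<le> ennreal ((sqrt A)\<^sup>2)" using A0 by simp
  note L = L2_norm_le_energy[OF wm E]
  show "f \<in> Hs s" using fL2 L(1) A0 by (simp add: Hs_def)
  have "Hs_norm s f \<le> sqrt A" "0 \<le> Hs_norm s f" using L(2) A0 by (auto simp: Hs_norm_def)
  then have "(Hs_norm s f)\<^sup>2 \<le> (sqrt A)\<^sup>2" by (intro power_mono)
  then show "(Hs_norm s f)\<^sup>2 \<le> \<alpha>\<^sup>2 * (2 * max 1 s * (1 + (norm \<eta>)\<^sup>2)) powr s"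
    using A0 by (simp add: A_def)
qed

lemma translation_opnorm_ge:
  fixes \<eta> y :: "real^2"
  assumes s: "0 \<le> s"
  shows "ennreal ((2 * max 1 s * (1 + (norm \<eta>)\<^sup>2)) powr (- s / 2) * \<bar>sin (2 * pi * (y \<bullet> \<eta>))\<bar> / 2) \<le> translation_opnorm s y"
proof -
  define P where "P = 2 * max 1 s * (1 + (norm \<eta>)\<^sup>2)"
  \<comment> \<open>The amplitude that normalises the wave packet in \<open>H\<^sup>s\<close>.\<close>
  define \<alpha> where "\<alpha> = P powr (- s / 2)"
  define f where "f = (\<lambda>x. phase (- (x \<bullet> \<eta>)) * complex_of_real (\<alpha> * gauss 1 x))"
  let ?S = "sin (2 * pi * (y \<bullet> \<eta>))"
  have P: "P > 0" unfolding P_def by (intro mult_pos_pos) (auto intro: add_pos_nonneg)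
  have "\<alpha>\<^sup>2 * P powr s = 1"
    using P by (simp add: \<alpha>_def power2_eq_square flip: powr_add)
  then have "(Hs_norm s f)\<^sup>2 \<le> 1\<^sup>2" and f: "f \<in> Hs s"
    using wave_packet_Hs[OF s, of \<eta> \<alpha>] unfolding f_def P_def by auto
  then have N: "Hs_norm s f \<le> 1" by (intro power2_le_imp_le[of "Hs_norm s f" 1]) auto
  have fL2: "f \<in> L2" and fm [measurable]: "f \<in> borel_measurable borel"
    using f by (auto simp: Hs_def L2_iff_energy)
  have "(\<lambda>x. f (x - y)) \<in> L2" using fL2 energy_translate[OF fm] by (auto simp: L2_iff_energy)
  then have dL2: "(\<lambda>x. f (x - y) - f x) \<in> L2" using fL2 by (rule L2_diff)
  have "(\<alpha> * \<bar>?S\<bar> / 2)\<^sup>2 \<le> \<alpha>\<^sup>2 * ?S\<^sup>2 / 2"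
    by (simp add: power_mult_distrib power_divide)
  then have "ennreal ((\<alpha> * \<bar>?S\<bar> / 2)\<^sup>2) \<le> energy (\<lambda>x. f (x - y) - f x)"
    unfolding f_def by (intro order_trans[OF ennreal_leI wave_packet_translation_energy])
  from L2_norm_ge_energy[OF dL2 this]
  have "ennreal (\<alpha> * \<bar>?S\<bar> / 2) \<le> ennreal (L2_norm (\<lambda>x. deform (\<lambda>_. y) f x - f x))"
    by (intro ennreal_leI) (simp add: deform_def)
  also have "\<dots> \<le> translation_opnorm s y"
    unfolding translation_opnorm_def using f N by (intro SUP_upper) auto
  finally show ?thesis unfolding \<alpha>_def P_def .
qed

lemma half_le_sin:
  fixes x :: real
  assumes "0 \<le> x" "x \<le> 1"
  shows "x / 2 \<le> sin x"
proof -
  have "\<bar>sin x - (\<Sum>m<3. sin_coeff m * x ^ m)\<bar> \<le> inverse (fact 3) * \<bar>x\<bar> ^ 3"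
    by (rule Maclaurin_sin_bound)
  moreover have "(\<Sum>m<3. sin_coeff m * x ^ m) = x"
    by (simp add: eval_nat_numeral sin_coeff_def)
  moreover have "\<bar>x\<bar> ^ 3 \<le> x"
    using assms power_decreasing[of 1 3 x] by simp
  ultimately have "\<bar>sin x - x\<bar> \<le> x / 6" by (simp add: fact_numeral)
  then show ?thesis using assms by linarith
qed

text \<open>
  For \<open>s \<le> 1\<close> the frequency of length \<open>1/(4|y|)\<close> makes the sine equal to \<open>1\<close>, while the
  normalisation of the wave packet costs a factor comparable to \<open>|y|\<close> to the power \<open>s\<close>.  For \<open>s > 1\<close> a
  frequency of length \<open>1/4\<close> costs only a constant, and the sine is comparable to \<open>|y|\<close>.
\<close>

lemma translation_opnorm_ge_powr:
  assumes s: "s > 0"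
  obtains c where "c > 0"
    "\<And>y. y \<noteq> 0 \<Longrightarrow> norm y \<le> 1/2 \<Longrightarrow> ennreal (c * norm y powr min s 1) \<le> translation_opnorm s y"
proof -
  define P where "P = (4 * max 1 s) powr (- s / 2)"
  have P: "P > 0" by (simp add: P_def)
  have key: "P * r powr (- s / 2) \<le> (2 * max 1 s * (1 + (norm \<eta>)\<^sup>2)) powr (- s / 2)"
    if "1 + (norm \<eta>)\<^sup>2 \<le> 2 * r" for r and \<eta> :: "real^2"
  proof -
    have pos: "0 < 1 + (norm \<eta>)\<^sup>2" by (simp add: add_pos_nonneg)
    then have "r > 0" using that by linarith
    have "2 * max 1 s * (1 + (norm \<eta>)\<^sup>2) \<le> 2 * max 1 s * (2 * r)" using that by (intro mult_left_mono) auto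
    then have "(2 * max 1 s * (2 * r)) powr (- s / 2) \<le> (2 * max 1 s * (1 + (norm \<eta>)\<^sup>2)) powr (- s / 2)"
      using s pos by (intro powr_mono2') auto
    moreover have "(2 * max 1 s * (2 * r)) powr (- s / 2) = ((4 * max 1 s) * r) powr (- s / 2)"
      by (simp add: ac_simps)
    ultimately show ?thesis using \<open>r > 0\<close> by (simp add: P_def powr_mult)
  qed
  show thesis
  proof (rule that[of "P / 4"])
    show "P / 4 > 0" using P by simp
    fix y :: "real^2" assume y: "y \<noteq> 0" "norm y \<le> 1/2"
    show "ennreal (P / 4 * norm y powr min s 1) \<le> translation_opnorm s y"
    proof (cases "s \<le> 1")
      case True
      define \<eta> where "\<eta> = (1 / (4 * (norm y)\<^sup>2)) *\<^sub>R y"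
      have "y \<bullet> \<eta> = 1 / 4" using y(1) by (simp add: \<eta>_def power2_norm_eq_inner)
      then have "2 * pi * (y \<bullet> \<eta>) = pi / 2" by simp
      then have S: "sin (2 * pi * (y \<bullet> \<eta>)) = 1" by (simp only: sin_pi_half)
      have "norm \<eta> = 1 / (4 * norm y)" using y(1) by (simp add: \<eta>_def power2_eq_square)
      then have "(norm \<eta>)\<^sup>2 = 1 / 16 * (1 / (norm y)\<^sup>2)" by (simp add: power_divide power_mult_distrib)
      moreover have "1 \<le> 1 / (norm y)\<^sup>2"
        using y power_le_one[of "norm y" 2] by (simp add: le_divide_eq)
      ultimately have "1 + (norm \<eta>)\<^sup>2 \<le> 2 * (1 / (norm y)\<^sup>2)" by linarith
      from key[OF this] have "P * (1 / (norm y)\<^sup>2) powr (- s / 2) \<le> (2 * max 1 s * (1 + (norm \<eta>)\<^sup>2)) powr (- s / 2)" .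
      moreover have "(1 / (norm y)\<^sup>2) powr (- s / 2) = norm y powr s"
      proof -
        have "((norm y)\<^sup>2) powr (s / 2) = norm y powr s"
          by (simp add: power2_eq_square powr_mult flip: powr_add)
        then show ?thesis using y(1) by (simp add: powr_divide powr_minus)
      qed
      ultimately have "P / 4 * norm y powr min s 1 \<le> (2 * max 1 s * (1 + (norm \<eta>)\<^sup>2)) powr (- s / 2) * \<bar>sin (2 * pi * (y \<bullet> \<eta>))\<bar> / 2"
        using P True unfolding S by (simp add: min_absorb1) (smt (verit) mult_nonneg_nonneg powr_ge_zero)
      then show ?thesis
        using translation_opnorm_ge[of s \<eta> y] s by (meson ennreal_leI less_imp_le order_trans)
    next
      case False
      define \<eta> where "\<eta> = (1 / (4 * norm y)) *\<^sub>R y"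
      have "y \<bullet> \<eta> = norm y / 4" using y(1) by (simp add: \<eta>_def power2_norm_eq_inner[symmetric] power2_eq_square)
      then have ang: "2 * pi * (y \<bullet> \<eta>) = pi / 2 * norm y" by simp
      have "pi / 2 * norm y \<le> 2 * (1/2)"
        using y(2) pi_less_4 by (intro mult_mono) auto
      then have "pi / 2 * norm y / 2 \<le> sin (2 * pi * (y \<bullet> \<eta>))" unfolding ang by (intro half_le_sin) auto
      moreover have "1 * norm y \<le> pi / 2 * norm y" using pi_gt3 by (intro mult_right_mono) auto
      ultimately have S: "norm y / 2 \<le> \<bar>sin (2 * pi * (y \<bullet> \<eta>))\<bar>" by linarith
      have "norm \<eta> = 1 / 4" using y(1) by (simp add: \<eta>_def)
      then have "(norm \<eta>)\<^sup>2 = 1 / 16" by (simp only: power2_eq_square)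
      then have "1 + (norm \<eta>)\<^sup>2 \<le> 2 * 1" by simp
      from key[OF this] have "P \<le> (2 * max 1 s * (1 + (norm \<eta>)\<^sup>2)) powr (- s / 2)" by simp
      then have "P * (norm y / 2) \<le> (2 * max 1 s * (1 + (norm \<eta>)\<^sup>2)) powr (- s / 2) * \<bar>sin (2 * pi * (y \<bullet> \<eta>))\<bar>"
        using P by (intro mult_mono S) auto
      then have "P / 4 * norm y powr min s 1 \<le> (2 * max 1 s * (1 + (norm \<eta>)\<^sup>2)) powr (- s / 2) * \<bar>sin (2 * pi * (y \<bullet> \<eta>))\<bar> / 2"
        using False y(1) by (simp add: min_absorb2)
      then show ?thesis
        using translation_opnorm_ge[of s \<eta> y] s by (meson ennreal_leI less_imp_le order_trans)
    qed
  qed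
qed

section \<open>The stability estimate and its sharpness\<close>

theorem corollary3p3:
  fixes s :: real
  assumes "s > 0"
  shows "(\<exists>C>0. input_stability_bound s C) \<and>
     (\<forall>C>0. input_stability_bound s C \<longrightarrow>
       (\<forall>T :: (real^2 \<Rightarrow> complex) \<Rightarrow> 'h::{real_inner,complete_space}.
          nonexpansive_L2 T \<longrightarrow>
          (\<forall>f\<in>Hs s. \<forall>\<tau>\<in>Cb1. sup_norm (Deriv \<tau>) \<le> 1 / 2 \<longrightarrow> sup_norm \<tau> \<le> 1 \<longrightarrow>
             norm (T (deform \<tau> f) - T f) \<le> C * sup_norm \<tau> powr min s 1 * Hs_norm s f))) \<and>
     (\<exists>c>0. \<exists>C>0. \<forall>\<^sub>F y in at (0 :: real^2).
        ennreal (c * norm y powr min s 1) \<le> translation_opnorm s y \<and>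
        translation_opnorm s y \<le> ennreal (C * norm y powr min s 1))"
proof (intro conjI)
  show "\<exists>C>0. input_stability_bound s C"
    unfolding input_stability_bound_def
    using deform_L2_norm_le(2)[OF assms] by (intro exI[of _ "32 * pi"]) auto
next
  show "\<forall>C>0. input_stability_bound s C \<longrightarrow>
       (\<forall>T :: (real^2 \<Rightarrow> complex) \<Rightarrow> 'h.
          nonexpansive_L2 T \<longrightarrow>
          (\<forall>f\<in>Hs s. \<forall>\<tau>\<in>Cb1. sup_norm (Deriv \<tau>) \<le> 1 / 2 \<longrightarrow> sup_norm \<tau> \<le> 1 \<longrightarrow>
             norm (T (deform \<tau> f) - T f) \<le> C * sup_norm \<tau> powr min s 1 * Hs_norm s f))"
  proof (intro allI impI ballI)
    fix C and T :: "(real^2 \<Rightarrow> complex) \<Rightarrow> 'h" and f \<tau>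
    assume bound: "input_stability_bound s C" and T: "nonexpansive_L2 T"
      and f: "f \<in> Hs s" and \<tau>: "\<tau> \<in> Cb1" "sup_norm (Deriv \<tau>) \<le> 1 / 2" "sup_norm \<tau> \<le> 1"
    have fL2: "f \<in> L2" using f by (simp add: Hs_def)
    have "(\<lambda>x. - f x) \<in> L2" using fL2 by (auto simp: L2_def)
    with deform_L2_norm_le(1)[OF assms f \<tau>(1,2)]
    have "(\<lambda>x. (deform \<tau> f x - f x) - (- f x)) \<in> L2" by (rule L2_diff)
    then have "deform \<tau> f \<in> L2" by simp
    then have "norm (T (deform \<tau> f) - T f) \<le> L2_norm (\<lambda>x. deform \<tau> f x - f x)"
      using T fL2 by (simp add: nonexpansive_L2_def)
    also have "\<dots> \<le> C * sup_norm \<tau> powr min s 1 * Hs_norm s f"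
      using bound f \<tau> by (simp add: input_stability_bound_def)
    finally show "norm (T (deform \<tau> f) - T f) \<le> C * sup_norm \<tau> powr min s 1 * Hs_norm s f" .
  qed
next
  obtain c where c: "c > 0"
    "\<And>y. y \<noteq> 0 \<Longrightarrow> norm y \<le> 1/2 \<Longrightarrow> ennreal (c * norm y powr min s 1) \<le> translation_opnorm s y"
    using translation_opnorm_ge_powr[OF assms] by blast
  have "\<forall>\<^sub>F y in at (0 :: real^2). y \<noteq> 0 \<and> norm y \<le> 1/2"
    unfolding eventually_at by (intro exI[of _ "1/2"]) auto
  then have "\<forall>\<^sub>F y in at (0 :: real^2).
        ennreal (c * norm y powr min s 1) \<le> translation_opnorm s y \<and>
        translation_opnorm s y \<le> ennreal (4 * pi * norm y powr min s 1)"
    by eventually_elim (use c translation_opnorm_le[OF assms] in auto)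
  then show "\<exists>c>0. \<exists>C>0. \<forall>\<^sub>F y in at (0 :: real^2).
        ennreal (c * norm y powr min s 1) \<le> translation_opnorm s y \<and>
        translation_opnorm s y \<le> ennreal (C * norm y powr min s 1)"
    using c(1) by (intro exI[of _ c] conjI exI[of _ "4 * pi"]) auto
qed

end
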